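(* Let $(Z_n)_{n\ge 0}$ be the $d$-type branching process with immigration in the stationary ergodic random environment $\omega$ described in the context, and assume: (A1) $E_P(\log^+\|I_0\|_1)<\infty$; (A2) $E_P(\log^+\|M_0\|_1)<\infty$; (A3) $\lim_{n\to\infty} n^{-1}E_P(\log\|M_{n-1}\cdots M_1M_0\|_1)<0$. Suppose in addition that there exists a constant $m\in\mathbb{N}$ such that $$P\big(P_\omega(Z_m=\mathbf{0}\mid Z_0=\mathbf{1})>0\big)>0 .$$ Then $\mathbb{P}(Z_n=\mathbf{0}\text{ i.o.})=1$. Moreover, if $$P\big(P_\omega(Z_1=\mathbf{0}\mid Z_0=\mathbf{1})>0\big)=1,$$ then $\mathbb{P}(\lim_{n\to\infty}\nu_n/n=\mu)=1$ for some constant $\mu>0$, where $\nu_0=0$ and $\nu_n=\inf\{i>\nu_{n-1}:Z_i=\mathbf{0}\}$ for $n\ge 1$ (with $\inf\emptyset=\infty$).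
   Context: Fix an integer $d\ge 1$. The environment $\omega=(\omega_n)_{n\in\mathbb{Z}}$ is a stationary ergodic sequence of random variables with values in a measurable space $(\mathcal{S},\mathcal{B})$; its law on $(\Omega,\mathcal{F})=(\mathcal{S}^{\mathbb{Z}},\mathcal{B}^{\otimes\mathbb{Z}})$ is $P$, with expectation $E_P$. Let $\mathcal{P}_d$ be the set of probability measures on $\mathbb{Z}_+^d$ ($\mathbb{Z}_+=\mathbb{N}\cup\{0\}$), and let $q,p_1,\dots,p_d:\mathcal{S}\to\mathcal{P}_d$ be measurable. Given $\omega$, under the quenched law $P_\omega$ (expectation $E_\omega$), all of the following random vectors in $\mathbb{Z}_+^d$ are independent: the immigration vectors $X_n=(X_n^{(1)},\dots,X_n^{(d)})$, $n\in\mathbb{Z}_+$, with $X_n$ of law $q_{\omega,n}=q(\omega_{n-1})$; and the offspring vectors $L_{n,m}^{(i)}=(L_{n,m}^{(i,1)},\dots,L_{n,m}^{(i,d)})$, $n\in\mathbb{Z}_+$, $m\in\mathbb{N}$, $1\le i\le d$, with $L_{n,m}^{(i)}$ of law $p^{(i)}_{\omega,n}=p_i(\omega_n)$. The process is defined by $Z_0=\mathbf{0}=(0,\dots,0)$ and $$Z_{n+1}=\sum_{i=1}^d\sum_{m=1}^{Z_n^{(i)}+X_n^{(i)}}L_{n,m}^{(i)},\qquad n\ge 0.$$ The joint (annealed) law is $\mathbb{P}=P\otimes P_\omega$. Under $P_\omega$, $(Z_n)$ is a nonhomogeneous Markov chain; $P_\omega(Z_m=\mathbf{0}\mid Z_0=\mathbf{1})$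 denotes the probability that the process given by the same recursion but started from $Z_0=\mathbf{1}=(1,\dots,1)$ is at $\mathbf{0}$ at time $m$. Write $I_n=I_n(\omega)=(E_\omega X_n^{(1)},\dots,E_\omega X_n^{(d)})$ and let $M_n=M_n(\omega)$ be the $d\times d$ matrix whose $i$th column is the vector $(E_\omega L_{n,1}^{(i,1)},\dots,E_\omega L_{n,1}^{(i,d)})$. For $v\in\mathbb{R}^d$, $\|v\|_1=\sum_i|v^{(i)}|$, and for a $d\times d$ matrix $A$, $\|A\|_1$ is the corresponding operator norm. $\log^+x=\max\{0,\log x\}$ and $\log 0=-\infty$. "i.o." means for infinitely many $n$. *)

theory Defs
  imports "HOL-Probability.Probability"
begin

text \<open>
  The environment is the coordinate process on the two-sided sequence space, under a law
  \<open>P\<close> on \<open>\<Pi>\<^sub>M n \<in> UNIV. S\<close>, where \<open>S\<close> is the state space.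
\<close>

definition env_shift :: "(int \<Rightarrow> 'a) \<Rightarrow> int \<Rightarrow> 'a" where
  "env_shift \<omega> = (\<lambda>n. \<omega> (n + 1))"

definition stationary_env :: "(int \<Rightarrow> 'a) measure \<Rightarrow> bool" where
  "stationary_env P \<longleftrightarrow> distr P P env_shift = P"

definition ergodic_env :: "(int \<Rightarrow> 'a) measure \<Rightarrow> bool" where
  "ergodic_env P \<longleftrightarrow>
     (\<forall>A\<in>sets P. env_shift -` A \<inter> space P = A \<longrightarrow> measure P A = 0 \<or> measure P A = 1)"

definition stationary_ergodic_env :: "'a measure \<Rightarrow> (int \<Rightarrow> 'a) measure \<Rightarrow> bool" where
  "stationary_ergodic_env S P \<longleftrightarrow>
     prob_space P \<and> sets P = sets (\<Pi>\<^sub>M n\<in>UNIV. S) \<and> stationary_env P \<and> ergodic_env P"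

text \<open>
  Types are indexed by \<open>'d\<close>, so that \<open>d = CARD('d)\<close>. The independent random vectors are indexed
  by \<open>'d source\<close>: the coordinate \<open>Immigrants n\<close> is \<open>X\<^sub>n\<close>, and \<open>Offspring n m i\<close> is the offspring
  vector at time \<open>n\<close> of the particle of type \<open>i\<close> with number \<open>m\<close>. Particles are numbered
  from 0 instead of 1.
\<close>

datatype 'd source = Immigrants nat | Offspring nat nat 'd

type_synonym 'd noise = "'d source \<Rightarrow> nat ^ 'd"

fun source_law ::
  "('a \<Rightarrow> (nat ^ 'd) measure) \<Rightarrow> ('d \<Rightarrow> 'a \<Rightarrow> (nat ^ 'd) measure) \<Rightarrow>
   (int \<Rightarrow> 'a) \<Rightarrow> 'd source \<Rightarrow> (nat ^ 'd) measure" where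
  "source_law q p \<omega> (Immigrants n) = q (\<omega> (int n - 1))"
| "source_law q p \<omega> (Offspring n m i) = p i (\<omega> (int n))"

definition quenched ::
  "('a \<Rightarrow> (nat ^ 'd) measure) \<Rightarrow> ('d \<Rightarrow> 'a \<Rightarrow> (nat ^ 'd) measure) \<Rightarrow>
   (int \<Rightarrow> 'a) \<Rightarrow> 'd noise measure" where
  "quenched q p \<omega> = (\<Pi>\<^sub>M s\<in>UNIV. source_law q p \<omega> s)"

text \<open>
  The joint law \<open>P \<otimes> P\<^sub>\<omega>\<close> of the environment and the noise, i.e. the measure
  \<open>C \<mapsto> \<integral> P\<^sub>\<omega> {x. (\<omega>, x) \<in> C} dP(\<omega>)\<close> on the product space.
\<close>

definition annealed ::
  "('a \<Rightarrow> (nat ^ 'd) measure) \<Rightarrow> ('d \<Rightarrow> 'a \<Rightarrow> (nat ^ 'd) measure) \<Rightarrow>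
   (int \<Rightarrow> 'a) measure \<Rightarrow> ((int \<Rightarrow> 'a) \<times> 'd noise) measure" where
  "annealed q p P =
     P \<bind> (\<lambda>\<omega>. distr (quenched q p \<omega>)
                   (P \<Otimes>\<^sub>M (\<Pi>\<^sub>M s\<in>UNIV. count_space UNIV)) (Pair \<omega>))"

text \<open>
  The kernel in \<open>annealed\<close> is measurable, so \<open>bind\<close> is not in a degenerate case there.
\<close>

lemma quenched_measurable:
  assumes sets: "sets P = sets (\<Pi>\<^sub>M n\<in>(UNIV::int set). S)"
    and [measurable]: "q \<in> S \<rightarrow>\<^sub>M prob_algebra (count_space UNIV)"
      "\<And>i. p i \<in> S \<rightarrow>\<^sub>M prob_algebra (count_space UNIV)"
  shows "quenched q p \<in> P \<rightarrow>\<^sub>M prob_algebra (\<Pi>\<^sub>M s\<in>UNIV. count_space UNIV)"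
proof -
  have [measurable_cong]: "sets P = sets (\<Pi>\<^sub>M n\<in>(UNIV::int set). S)" by fact
  have law[measurable]: "(\<lambda>\<omega>. source_law q p \<omega> s) \<in> P \<rightarrow>\<^sub>M prob_algebra (count_space UNIV)" for s
    by (cases s) (simp_all)
  have law_sp: "prob_space (source_law q p \<omega> s)" "sets (source_law q p \<omega> s) = UNIV" if "\<omega> \<in> space P" for \<omega> s
    using measurable_space[OF law that] by (auto simp: space_prob_algebra)
  show ?thesis
  proof (rule measurable_prob_algebra_generated[OF sets_PiM Int_stable_prod_algebra prod_algebra_sets_into_space])
    fix \<omega> assume w: "\<omega> \<in> space P"
    show "prob_space (quenched q p \<omega>)" unfolding quenched_def
      by (intro prob_space_PiM law_sp w)
    show "sets (quenched q p \<omega>) = sets (\<Pi>\<^sub>M s\<in>UNIV. count_space UNIV)"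
      unfolding quenched_def by (intro sets_PiM_cong) (auto simp: law_sp w)
  next
    fix A assume "A \<in> prod_algebra UNIV (\<lambda>s :: 'b source. count_space (UNIV :: (nat^'b) set))"
    then obtain J X where A: "A = prod_emb UNIV (\<lambda>s. count_space UNIV) J (Pi\<^sub>E J X)" "finite J"
      by (elim prod_algebraE) auto
    have "emeasure (quenched q p \<omega>) A = (\<Prod>s\<in>J. emeasure (source_law q p \<omega> s) (X s))" if w: "\<omega> \<in> space P" for \<omega>
    proof -
      interpret product_prob_space "source_law q p \<omega>" UNIV
        using law_sp[OF w] by (simp add: product_prob_space_def product_prob_space_axioms_def product_sigma_finite_def prob_space_imp_sigma_finite)
      have sp: "space (source_law q p \<omega> s) = UNIV" for s
        using sets_eq_imp_space_eq[of "source_law q p \<omega> s" "count_space UNIV"] law_sp(2)[OF w] by simp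
      have "A = prod_emb UNIV (source_law q p \<omega>) J (Pi\<^sub>E J X)"
        unfolding A prod_emb_def by (simp add: sp)
      then show ?thesis unfolding quenched_def
        using A by (simp only:) (intro emeasure_PiM_emb, auto simp: law_sp w)
    qed
    moreover have "(\<lambda>\<omega>. \<Prod>s\<in>J. emeasure (source_law q p \<omega> s) (X s)) \<in> borel_measurable P"
      by (intro borel_measurable_prod_ennreal
          measurable_emeasure_kernel[OF measurable_prob_algebraD[OF law]]) simp
    ultimately show "(\<lambda>\<omega>. emeasure (quenched q p \<omega>) A) \<in> borel_measurable P"
      by (subst measurable_cong) auto
  qed
qed

lemma annealed_law:
  assumes P: "prob_space P" and sets: "sets P = sets (\<Pi>\<^sub>M n\<in>(UNIV::int set). S)"
    and q: "q \<in> S \<rightarrow>\<^sub>M prob_algebra (count_space UNIV)"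
    and p: "\<And>i. p i \<in> S \<rightarrow>\<^sub>M prob_algebra (count_space UNIV)"
  shows prob_space_annealed: "prob_space (annealed q p P)"
   and emeasure_annealed: "C \<in> sets (P \<Otimes>\<^sub>M (\<Pi>\<^sub>M s\<in>UNIV. count_space UNIV)) \<Longrightarrow>
     emeasure (annealed q p P) C = (\<integral>\<^sup>+\<omega>. emeasure (quenched q p \<omega>) (Pair \<omega> -` C) \<partial>P)"
proof -
  let ?N = "\<Pi>\<^sub>M s\<in>(UNIV::'b source set). count_space (UNIV::(nat^'b) set)"
  have Q[measurable]: "quenched q p \<in> P \<rightarrow>\<^sub>M prob_algebra ?N"
    by (rule quenched_measurable[OF sets q p])
  let ?K = "\<lambda>\<omega>. distr (quenched q p \<omega>) (P \<Otimes>\<^sub>M ?N) (Pair \<omega>)"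
  have K: "?K \<in> P \<rightarrow>\<^sub>M prob_algebra (P \<Otimes>\<^sub>M ?N)"
    by (rule measurable_distr_prob_space2[where M="?N"]) measurable
  have Pa: "P \<in> space (prob_algebra P)" using P by (simp add: space_prob_algebra)
  show "prob_space (annealed q p P)"
    unfolding annealed_def by (rule prob_space_bind'[OF Pa K])
  assume C: "C \<in> sets (P \<Otimes>\<^sub>M ?N)"
  have "emeasure (annealed q p P) C = (\<integral>\<^sup>+\<omega>. emeasure (?K \<omega>) C \<partial>P)"
    unfolding annealed_def by (rule emeasure_bind_prob_algebra[OF Pa K C])
  also have "\<dots> = (\<integral>\<^sup>+\<omega>. emeasure (quenched q p \<omega>) (Pair \<omega> -` C) \<partial>P)"
  proof (rule nn_integral_cong)
    fix \<omega> assume w: "\<omega> \<in> space P"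
    have s: "sets (quenched q p \<omega>) = sets ?N"
      using measurable_space[OF Q w] by (simp add: space_prob_algebra)
    have "space (quenched q p \<omega>) = UNIV"
      using sets_eq_imp_space_eq[OF s] by (simp add: space_PiM)
    moreover have "Pair \<omega> \<in> quenched q p \<omega> \<rightarrow>\<^sub>M P \<Otimes>\<^sub>M ?N"
      using w by (simp cong: measurable_cong_sets add: s)
    ultimately show "emeasure (?K \<omega>) C = emeasure (quenched q p \<omega>) (Pair \<omega> -` C)"
      using C by (simp add: emeasure_distr)
  qed
  finally show "emeasure (annealed q p P) C = (\<integral>\<^sup>+\<omega>. emeasure (quenched q p \<omega>) (Pair \<omega> -` C) \<partial>P)" .
qed

primrec branching :: "nat ^ 'd::finite \<Rightarrow> 'd noise \<Rightarrow> nat \<Rightarrow> nat ^ 'd" where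
  "branching z x 0 = z"
| "branching z x (Suc n) =
     (\<Sum>i\<in>UNIV. \<Sum>m<branching z x n $ i + x (Immigrants n) $ i. x (Offspring n m i))"

definition quenched_extinction ::
  "('a \<Rightarrow> (nat ^ 'd::finite) measure) \<Rightarrow> ('d \<Rightarrow> 'a \<Rightarrow> (nat ^ 'd) measure) \<Rightarrow>
   (int \<Rightarrow> 'a) \<Rightarrow> nat \<Rightarrow> real" where
  "quenched_extinction q p \<omega> m =
     measure (quenched q p \<omega>) {x \<in> space (quenched q p \<omega>). branching 1 x m = 0}"

text \<open>
  Quenched means are Bochner integrals, which are 0 for non-integrable functions; the
  predicates \<open>finite_imm_mean\<close> and \<open>finite_offspring_mean\<close> say that they are genuine means.
\<close>

definition finite_imm_mean ::
  "('a \<Rightarrow> (nat ^ 'd) measure) \<Rightarrow> ('d \<Rightarrow> 'a \<Rightarrow> (nat ^ 'd) measure) \<Rightarrow>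
   (int \<Rightarrow> 'a) \<Rightarrow> nat \<Rightarrow> bool" where
  "finite_imm_mean q p \<omega> n \<longleftrightarrow>
     (\<forall>i. integrable (quenched q p \<omega>) (\<lambda>x. real (x (Immigrants n) $ i)))"

definition imm_mean ::
  "('a \<Rightarrow> (nat ^ 'd) measure) \<Rightarrow> ('d \<Rightarrow> 'a \<Rightarrow> (nat ^ 'd) measure) \<Rightarrow>
   (int \<Rightarrow> 'a) \<Rightarrow> nat \<Rightarrow> real ^ 'd" where
  "imm_mean q p \<omega> n = (\<chi> i. \<integral>x. real (x (Immigrants n) $ i) \<partial>quenched q p \<omega>)"

definition finite_offspring_mean ::
  "('a \<Rightarrow> (nat ^ 'd) measure) \<Rightarrow> ('d \<Rightarrow> 'a \<Rightarrow> (nat ^ 'd) measure) \<Rightarrow>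
   (int \<Rightarrow> 'a) \<Rightarrow> nat \<Rightarrow> bool" where
  "finite_offspring_mean q p \<omega> n \<longleftrightarrow>
     (\<forall>i j. integrable (quenched q p \<omega>) (\<lambda>x. real (x (Offspring n 0 i) $ j)))"

text \<open>Column \<open>i\<close> (second index) is the mean offspring vector of a particle of type \<open>i\<close>.\<close>

definition offspring_mean ::
  "('a \<Rightarrow> (nat ^ 'd) measure) \<Rightarrow> ('d \<Rightarrow> 'a \<Rightarrow> (nat ^ 'd) measure) \<Rightarrow>
   (int \<Rightarrow> 'a) \<Rightarrow> nat \<Rightarrow> real ^ 'd ^ 'd" where
  "offspring_mean q p \<omega> n =
     (\<chi> j i. \<integral>x. real (x (Offspring n 0 i) $ j) \<partial>quenched q p \<omega>)"

primrec mean_product ::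
  "('a \<Rightarrow> (nat ^ 'd::finite) measure) \<Rightarrow> ('d \<Rightarrow> 'a \<Rightarrow> (nat ^ 'd) measure) \<Rightarrow>
   (int \<Rightarrow> 'a) \<Rightarrow> nat \<Rightarrow> real ^ 'd ^ 'd" where
  "mean_product q p \<omega> 0 = mat 1"
| "mean_product q p \<omega> (Suc n) = offspring_mean q p \<omega> n ** mean_product q p \<omega> n"

definition norm1 :: "real ^ 'd::finite \<Rightarrow> real" where
  "norm1 v = (\<Sum>i\<in>UNIV. \<bar>v $ i\<bar>)"

text \<open>The library's \<open>onorm\<close> is the operator norm for the Euclidean norm on \<open>real ^ 'd\<close>.\<close>

definition opnorm1 :: "real ^ 'd ^ 'd::finite \<Rightarrow> real" where
  "opnorm1 A = (SUP v\<in>{v. norm1 v \<le> 1}. norm1 (A *v v))"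

text \<open>The library's \<open>ln\<close> has \<open>ln 0 = 0\<close>; here \<open>log 0 = -\<infinity>\<close>.\<close>

definition elog :: "real \<Rightarrow> ereal" where
  "elog x = (if x = 0 then -\<infinity> else ereal (ln x))"

text \<open>
  Expectation of an extended real function, as the difference of the integrals of its positive
  and negative parts (\<open>e2ennreal\<close> truncates at 0).
  The degenerate case \<open>\<infinity> - \<infinity>\<close> has the value \<open>\<infinity>\<close>.
\<close>

definition eexpectation :: "'b measure \<Rightarrow> ('b \<Rightarrow> ereal) \<Rightarrow> ereal" where
  "eexpectation M f =
     enn2ereal (\<integral>\<^sup>+x. e2ennreal (f x) \<partial>M) - enn2ereal (\<integral>\<^sup>+x. e2ennreal (- f x) \<partial>M)"

text \<open>Successive times \<open>i > 0\<close> at which \<open>Z i = 0\<close>; on \<open>enat\<close> the infimum of \<open>{}\<close> is \<open>\<infinity>\<close>.\<close>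

primrec zero_time :: "(nat \<Rightarrow> 'b::zero) \<Rightarrow> nat \<Rightarrow> enat" where
  "zero_time Z 0 = 0"
| "zero_time Z (Suc n) = Inf {enat i | i. zero_time Z n < enat i \<and> Z i = 0}"

end

(*
  The idea.  Particles of the process started at time n are among those of the process started at
  time 0, so the number N_n of zeros of Z in {1..n} is subadditive along the joint shift T of
  environment and noise: N_(n+k) <= N_n + N_k o T^n.  The joint shift is ergodic, because the
  sections of an invariant set are tail events of the (conditionally independent) noise.  Hence
  N_n / n converges almost surely to the constant c = inf_n E N_n / n, as in Kingman's theorem, and
  nu_n / n tends to 1 / c as soon as c > 0.  No stationary version of Z is needed.

  For c > 0 it suffices that P(Z_n = 0) is bounded below.  By stationarity the quenched mean of Z_n
  is distributed like a partial sum of the series of ||M_(-1) ... M_(-j)|| ||I_(-j)||, which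
  converges almost surely by (A1)-(A3); so Z_n is tight.  From at most K particles of each type the
  process reaches 0 after m more steps with positive probability on an environment event whose
  probability does not depend on K, because the quenched generating function is a monomial in the
  starting vector.
*)
theory Submission
  imports Defs
begin

section \<open>Subadditive sequences over an ergodic transformation\<close>

text \<open>The two halves of Kingman's theorem are proved separately. The upper half is kept in a
  general form: one index \<open>N\<close> with a negative mean already makes a subadditive sequence
  bounded above almost surely. In this form it serves three times: for the zero count under the
  joint shift, and, under the inverse environment shift, for the exponential decay of matrix
  products and the sublinear growth of the logarithm of the immigration mean. The obstacle to
  tightness is that the quenched mean of Z_n along a fixed environment need not settle down as n
  grows. Seen from time n, immigrants of age j contribute a term that no longer depends on n, so a
  single almost sure bound covers all n; stationarity then carries it back to each fixed n. In (A3)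
  the expectations may be -infinity, since the products can vanish. The logarithms are therefore
  truncated from below, by a cutoff that is exponential in time so that submultiplicativity
  survives.\<close>

locale ergodic_system = prob_space M for M :: "'a measure" +
  fixes T :: "'a \<Rightarrow> 'a"
  assumes T_meas [measurable]: "T \<in> M \<rightarrow>\<^sub>M M"
    and T_preserving: "distr M M T = M"
    and T_ergodic: "A \<in> sets M \<Longrightarrow> T -` A \<inter> space M = A \<Longrightarrow> prob A = 0 \<or> prob A = 1"
begin

lemma funpow_meas [measurable]: "T ^^ n \<in> M \<rightarrow>\<^sub>M M"
  by (induction n) (auto simp: id_def intro!: measurable_comp[OF _ T_meas])

lemma funpow_preserving: "distr M M (T ^^ n) = M"
proof (induction n)
  case 0 then show ?case by (simp add: id_def distr_id)
next
  case (Suc n)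
  have "distr M M (T ^^ Suc n) = distr (distr M M (T ^^ n)) M T"
    by (subst distr_distr) (auto simp: comp_def)
  then show ?case using Suc T_preserving by (simp add: comp_def)
qed

lemma prob_vimage_funpow: "A \<in> sets M \<Longrightarrow> prob ((T ^^ n) -` A \<inter> space M) = prob A"
  by (metis funpow_meas funpow_preserving measure_distr)

lemma integrable_funpow:
  fixes f :: "'a \<Rightarrow> real"
  assumes "integrable M f" shows "integrable M (\<lambda>x. f ((T ^^ n) x))"
  using assms funpow_preserving[of n] integrable_distr[OF funpow_meas, of n f] by simp

lemma integral_funpow:
  fixes f :: "'a \<Rightarrow> real"
  assumes [measurable]: "f \<in> borel_measurable M"
  shows "(\<integral>x. f ((T ^^ n) x) \<partial>M) = (\<integral>x. f x \<partial>M)"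
  using integral_distr[OF funpow_meas assms, of n] funpow_preserving[of n] by simp

lemma AE_funpow: "AE x in M. Q x \<Longrightarrow> AE x in M. Q ((T ^^ n) x)"
  by (rule AE_distrD[OF funpow_meas]) (unfold funpow_preserving)

text \<open>The iterated preimages of \<open>A\<close> increase and all have the measure of
  \<open>A\<close>; their union is strictly invariant, so \<open>T_ergodic\<close> applies to it.
  One-sided inclusions are what subadditivity supplies for events such as unboundedness.\<close>

lemma zero_one_of_subset_vimage:
  assumes [measurable]: "A \<in> sets M" and sub: "A \<subseteq> T -` A"
  shows "prob A = 0 \<or> prob A = 1"
proof -
  define B where "B n = (T ^^ n) -` A \<inter> space M" for n
  have [measurable]: "B n \<in> sets M" for n unfolding B_def by measurable
  have B0: "A = B 0" using sets.sets_into_space[OF assms(1)] by (auto simp: B_def)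
  have Bsuc: "T -` B n \<inter> space M = B (Suc n)" for n
    using measurable_space[OF T_meas] by (auto simp: B_def funpow_swap1)
  have "B n \<subseteq> B (Suc n)" for n using sub by (auto simp: B_def)
  then have inc: "incseq B" by (rule incseq_SucI)
  have "T -` (\<Union>n. B n) \<inter> space M = (\<Union>n. B (Suc n))" using Bsuc by auto
  also have "\<dots> = (\<Union>n. B n)"
    using incseq_SucD[OF inc] by blast
  finally have "prob (\<Union>n. B n) = 0 \<or> prob (\<Union>n. B n) = 1" by (intro T_ergodic) auto
  moreover have "(\<lambda>n. prob (B n)) \<longlonglongrightarrow> prob (\<Union>n. B n)"
    by (rule finite_Lim_measure_incseq) (use inc in auto)
  moreover have "prob (B n) = prob A" for n
    unfolding B_def by (rule prob_vimage_funpow) simp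
  ultimately show ?thesis using LIMSEQ_unique[OF tendsto_const] by force
qed

lemma zero_one_of_vimage_subset:
  assumes [measurable]: "A \<in> sets M" and sub: "T -` A \<inter> space M \<subseteq> A"
  shows "prob A = 0 \<or> prob A = 1"
proof -
  have "prob (space M - A) = 0 \<or> prob (space M - A) = 1"
    using measurable_space[OF T_meas] sub
    by (intro zero_one_of_subset_vimage) auto
  then show ?thesis using prob_compl[of A] by auto
qed

text \<open>
  If the running maxima \<open>m n\<close> of \<open>g\<close> tended to infinity, then
  \<open>m (n + N) - m n \<circ> T ^^ N\<close> would eventually be at most \<open>g N\<close>, although its integral is nonnegative.
\<close>

lemma subadditive_AE_bdd_above:
  fixes g :: "nat \<Rightarrow> 'a \<Rightarrow> real"
  assumes [measurable]: "\<And>n. g n \<in> borel_measurable M"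
    and sub: "\<And>n k x. x \<in> space M \<Longrightarrow> g (n + k) x \<le> g n x + g k ((T ^^ n) x)"
    and int_pos: "\<And>n. integrable M (\<lambda>x. max 0 (g n x))"
    and int_N: "integrable M (g N)" and neg: "(\<integral>x. g N x \<partial>M) < 0"
  shows "AE x in M. bdd_above (range (\<lambda>n. g n x))"
proof -
  define A where "A = {x \<in> space M. \<forall>c::nat. \<exists>n. g n x > real c}"
  have [measurable]: "A \<in> sets M" unfolding A_def by measurable
  have A_iff: "x \<in> A \<longleftrightarrow> x \<in> space M \<and> \<not> bdd_above (range (\<lambda>n. g n x))" for x
  proof -
    have "(\<forall>c::nat. \<exists>n. g n x > real c) \<longleftrightarrow> \<not> bdd_above (range (\<lambda>n. g n x))"
    proof (intro iffI allI)
      assume *: "\<forall>c::nat. \<exists>n. g n x > real c"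
      show "\<not> bdd_above (range (\<lambda>n. g n x))"
      proof
        assume "bdd_above (range (\<lambda>n. g n x))"
        then obtain C where C: "\<And>n. g n x \<le> C" by (auto simp: bdd_above_def)
        obtain k :: nat where "C \<le> real k" using real_arch_simple by blast
        with * obtain n where "C < g n x" by (metis order_le_less_trans)
        with C[of n] show False by simp
      qed
    qed (force simp: bdd_above_def not_le)
    then show ?thesis by (auto simp: A_def)
  qed
  have "A \<subseteq> T -` A"
  proof
    fix x assume x: "x \<in> A"
    then have xs: "x \<in> space M" and Tx: "T x \<in> space M"
      using measurable_space[OF T_meas] by (auto simp: A_def)
    have "\<not> bdd_above (range (\<lambda>n. g n (T x)))"
    proof
      assume "bdd_above (range (\<lambda>n. g n (T x)))"
      then obtain C where C: "\<And>n. g n (T x) \<le> C" by (auto simp: bdd_above_def)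
      have "g n x \<le> max (g 0 x) (g 1 x + C)" for n
        using sub[OF xs, of 1 "n - 1"] C[of "n - 1"] by (cases n) auto
      then have "bdd_above (range (\<lambda>n. g n x))" by (auto simp: bdd_above_def)
      then show False using x A_iff by auto
    qed
    then show "x \<in> T -` A" using A_iff Tx by auto
  qed
  then have "prob A = 0 \<or> prob A = 1" by (rule zero_one_of_subset_vimage[rotated]) simp
  moreover have "prob A \<noteq> 1"
  proof
    assume "prob A = 1"
    then have AE_A: "AE x in M. x \<in> A" by (simp add: AE_in_set_eq_1)
    define m where "m n x = Max ((\<lambda>k. max 0 (g k x)) ` {..n})" for n x
    have m_meas[measurable]: "m n \<in> borel_measurable M" for n
      unfolding m_def by (intro borel_measurable_Max) auto
    have m_ge: "max 0 (g k x) \<le> m n x" if "k \<le> n" for k n x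
      unfolding m_def using that by (intro Max_ge) auto
    have m_nonneg: "0 \<le> m n x" for n x using m_ge[of 0 n x] by auto
    have m_le: "m n x \<le> c" if "\<And>k. k \<le> n \<Longrightarrow> max 0 (g k x) \<le> c" for n x c
      unfolding m_def using that by (subst Max_le_iff) auto
    have m_int: "integrable M (m n)" for n
    proof (rule Bochner_Integration.integrable_bound)
      show "integrable M (\<lambda>x. \<Sum>k\<le>n. max 0 (g k x))" using int_pos by auto
      show "AE x in M. norm (m n x) \<le> norm (\<Sum>k\<le>n. max 0 (g k x))"
      proof (rule AE_I2)
        fix x
        have "m n x \<le> (\<Sum>k\<le>n. max 0 (g k x))"
          by (rule m_le, rule member_le_sum) auto
        then show "norm (m n x) \<le> norm (\<Sum>k\<le>n. max 0 (g k x))"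
          using m_nonneg[of n x] by simp
      qed
    qed auto
    \<comment> \<open>Splitting indices up to \<open>n + N\<close> at \<open>N\<close> bounds
      \<open>m (n + N) x - m n ((T ^^ N) x)\<close> by \<open>E n x\<close>. The cutoff from below
      at \<open>g N x\<close> makes \<open>E n\<close> dominated, and \<open>E n x\<close> equals
      \<open>g N x\<close> once \<open>m n ((T ^^ N) x)\<close> has reached
      \<open>m N x - g N x\<close>.\<close>
    define E where "E n x = max (m N x - m n ((T ^^ N) x)) (g N x)" for n x
    have bound_int: "integrable M (\<lambda>x. m N x + \<bar>g N x\<bar>)"
      using m_int int_N by auto
    have E_bound: "norm (E n x) \<le> m N x + \<bar>g N x\<bar>" for n x
      using m_nonneg[of N x] m_nonneg[of n "(T ^^ N) x"] unfolding E_def by auto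
    have [measurable]: "E n \<in> borel_measurable M" for n unfolding E_def by measurable
    have E_int: "integrable M (E n)" for n
      by (rule Bochner_Integration.integrable_bound[OF bound_int])
        (use E_bound m_nonneg in \<open>auto intro!: AE_I2 intro: order_trans\<close>)
    have E_nonneg: "0 \<le> (\<integral>x. E n x \<partial>M)" for n
    proof -
      have "(\<integral>x. m n ((T ^^ N) x) \<partial>M) = (\<integral>x. m n x \<partial>M)" by (rule integral_funpow) simp
      also have "\<dots> \<le> (\<integral>x. m (n + N) x \<partial>M)"
        by (intro integral_mono m_int m_le m_ge) auto
      finally have "0 \<le> (\<integral>x. m (n + N) x - m n ((T ^^ N) x) \<partial>M)"
        by (subst Bochner_Integration.integral_diff) (auto intro: m_int integrable_funpow)
      also have "\<dots> \<le> (\<integral>x. E n x \<partial>M)"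
      proof (rule integral_mono)
        show "integrable M (\<lambda>x. m (n + N) x - m n ((T ^^ N) x))"
          using m_int integrable_funpow[OF m_int] by auto
        fix x assume x: "x \<in> space M"
        have "m (n + N) x \<le> max (m N x) (g N x + m n ((T ^^ N) x))"
        proof (rule m_le)
          fix k assume k: "k \<le> n + N"
          show "max 0 (g k x) \<le> max (m N x) (g N x + m n ((T ^^ N) x))"
          proof (cases "k \<le> N")
            case True then show ?thesis using m_ge[of k N x] by auto
          next
            case False
            then obtain l where l: "k = N + l" "l \<le> n" using k
              by (metis add.commute add_le_cancel_left le_add_diff_inverse nat_le_linear)
            show ?thesis
              using sub[OF x, of N l] m_ge[OF l(2), of "(T ^^ N) x"] m_nonneg[of N x] l by auto
          qed
        qed
        then show "m (n + N) x - m n ((T ^^ N) x) \<le> E n x" by (auto simp: E_def)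
      qed (rule E_int)
      finally show ?thesis .
    qed
    have "(\<lambda>n. \<integral>x. E n x \<partial>M) \<longlonglongrightarrow> (\<integral>x. g N x \<partial>M)"
    proof (rule integral_dominated_convergence[OF _ _ bound_int])
      show "AE x in M. (\<lambda>n. E n x) \<longlonglongrightarrow> g N x"
        using AE_funpow[OF AE_A, of N]
      proof eventually_elim
        case (elim x)
        obtain c :: nat where c: "m N x - g N x \<le> real c" using real_arch_simple by blast
        obtain n0 where n0: "real c < g n0 ((T ^^ N) x)" using elim by (auto simp: A_def)
        have "E n x = g N x" if "n \<ge> n0" for n
          using m_ge[OF that, of "(T ^^ N) x"] n0 c by (auto simp: E_def)
        then show ?case
          by (intro tendsto_eventually) (auto simp: eventually_sequentially)
      qed
    qed (use E_bound in auto)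
    then have "0 \<le> (\<integral>x. g N x \<partial>M)"
      by (rule LIMSEQ_le_const) (use E_nonneg in auto)
    then show False using neg by simp
  qed
  ultimately have "prob A = 0" by simp
  then have "AE x in M. x \<notin> A" by (simp add: AE_iff_measurable[OF _ refl] prob_eq_0)
  then show ?thesis using A_iff by (auto elim: AE_mp)
qed

text \<open>A covering argument: where some block of length at most \<open>K\<close> costs at most
  \<open>b\<close> per unit of time, jump over it; elsewhere advance one step at cost at most 1. The
  mean cost per unit of time is then at most \<open>b + prob (B K)\<close> in the limit. If
  \<open>g n x - b * real n\<close> were almost surely unbounded below, \<open>prob (B K)\<close>
  would tend to 0, against \<open>b < c\<close>.\<close>

lemma bounded_subadditive_AE_bdd_below:
  fixes g :: "nat \<Rightarrow> 'a \<Rightarrow> real"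
  assumes [measurable]: "\<And>n. g n \<in> borel_measurable M"
    and sub: "\<And>n k x. x \<in> space M \<Longrightarrow> g (n + k) x \<le> g n x + g k ((T ^^ n) x)"
    and bound: "\<And>n x. x \<in> space M \<Longrightarrow> 0 \<le> g n x \<and> g n x \<le> real n"
    and mean: "\<And>n. c * real n \<le> (\<integral>x. g n x \<partial>M)" and "b < c" "0 \<le> b"
  shows "AE x in M. bdd_below (range (\<lambda>n. g n x - b * real n))"
proof -
  define A where "A = {x \<in> space M. \<forall>k::nat. \<exists>n. g n x - b * real n < - real k}"
  have [measurable]: "A \<in> sets M" unfolding A_def by measurable
  have A_iff: "x \<in> A \<longleftrightarrow> x \<in> space M \<and> \<not> bdd_below (range (\<lambda>n. g n x - b * real n))" for x
  proof -
    have "(\<forall>k::nat. \<exists>n. g n x - b * real n < - real k) \<longleftrightarrow> \<not> bdd_below (range (\<lambda>n. g n x - b * real n))"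
    proof (intro iffI allI)
      assume *: "\<forall>k::nat. \<exists>n. g n x - b * real n < - real k"
      show "\<not> bdd_below (range (\<lambda>n. g n x - b * real n))"
      proof
        assume "bdd_below (range (\<lambda>n. g n x - b * real n))"
        then obtain C where C: "\<And>n. C \<le> g n x - b * real n" by (auto simp: bdd_below_def)
        obtain k :: nat where "- C \<le> real k" using real_arch_simple by blast
        with * obtain n where "g n x - b * real n < C" by (metis minus_le_iff order_less_le_trans)
        with C[of n] show False by simp
      qed
    qed (force simp: bdd_below_def not_le)
    then show ?thesis by (auto simp: A_def)
  qed
  have "T -` A \<inter> space M \<subseteq> A"
  proof
    fix x assume x: "x \<in> T -` A \<inter> space M"
    have "\<not> bdd_below (range (\<lambda>n. g n x - b * real n))"
    proof
      assume "bdd_below (range (\<lambda>n. g n x - b * real n))"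
      then obtain C where C: "\<And>n. C \<le> g n x - b * real n" by (auto simp: bdd_below_def)
      have "C - 1 + b \<le> g n (T x) - b * real n" for n
        using sub[of x 1 n] C[of "Suc n"] bound[of x 1] x by (auto simp: algebra_simps)
      then have "bdd_below (range (\<lambda>n. g n (T x) - b * real n))" by (auto simp: bdd_below_def)
      then show False using x A_iff by auto
    qed
    then show "x \<in> A" using A_iff x by auto
  qed
  then have "prob A = 0 \<or> prob A = 1" by (rule zero_one_of_vimage_subset[rotated]) simp
  moreover have "prob A \<noteq> 1"
  proof
    assume "prob A = 1"
    then have AE_A: "AE x in M. x \<in> A" by (simp add: AE_in_set_eq_1)
    \<comment> \<open>The points from which no block of length at most \<open>K\<close> is
      cheap.\<close>
    define B where "B K = {x \<in> space M. \<forall>j\<in>{1..K}. b * real j < g j x}" for K :: nat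
    have [measurable]: "B K \<in> sets M" for K unfolding B_def by measurable
    have mean_le: "c \<le> b + prob (B K)" for K
    proof -
      \<comment> \<open>Strong induction along the jumps. The extra \<open>real K\<close> pays for
        the final stretch shorter than \<open>K\<close>, where only
        \<open>g n x \<le> real n\<close> is available.\<close>
      have le: "g n x \<le> b * real n + (\<Sum>k<n. indicator (B K) ((T ^^ k) x)) + real K" if "x \<in> space M" for n x
        using that
      proof (induction n arbitrary: x rule: less_induct)
        case (less n)
        have Tj: "(T ^^ j) x \<in> space M" for j using measurable_space[OF funpow_meas less.prems] .
        consider "n < K" | "n = 0" | "n \<ge> K" "n \<noteq> 0" "x \<in> B K" | "n \<ge> K" "n \<noteq> 0" "x \<notin> B K" by linarith
        then show ?case
        proof cases
          case 1
          have "0 \<le> (\<Sum>k<n. indicat_real (B K) ((T ^^ k) x))" by (intro sum_nonneg) auto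
          with 1 show ?thesis using bound[OF less.prems, of n] \<open>0 \<le> b\<close>
            by (smt (verit) mult_nonneg_nonneg of_nat_0_le_iff of_nat_less_iff)
        next
          case 2
          then show ?thesis using bound[OF less.prems, of n] by auto
        next
          case 3
          then obtain l where l: "n = Suc l" by (cases n) auto
          have "g n x \<le> g 1 x + g l (T x)" using sub[OF less.prems, of 1 l] l by simp
          also have "\<dots> \<le> 1 + (b * real l + (\<Sum>k<l. indicator (B K) ((T ^^ k) (T x))) + real K)"
            using less.IH[of l "T x"] l bound[OF less.prems, of 1] Tj[of 1] by auto
          also have "\<dots> \<le> b * real n + (\<Sum>k<n. indicator (B K) ((T ^^ k) x)) + real K"
            using 3 \<open>0 \<le> b\<close> unfolding l sum.lessThan_Suc_shift
            by (simp add: funpow_swap1 algebra_simps)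
          finally show ?thesis .
        next
          case 4
          then obtain j where j: "1 \<le> j" "j \<le> K" "g j x \<le> b * real j"
            using less.prems by (auto simp: B_def not_less)
          then obtain l where l: "n = j + l" using 4 by (metis le_iff_add order_trans)
          have "g n x \<le> g j x + g l ((T ^^ j) x)" using sub[OF less.prems, of j l] l by simp
          also have "\<dots> \<le> b * real j + (b * real l + (\<Sum>k<l. indicator (B K) ((T ^^ k) ((T ^^ j) x))) + real K)"
            using less.IH[of l "(T ^^ j) x"] j l Tj[of j] by auto
          also have "(\<Sum>k<l. indicat_real (B K) ((T ^^ k) ((T ^^ j) x))) = (\<Sum>k\<in>{j..<n}. indicator (B K) ((T ^^ k) x))"
            unfolding l by (rule sum.reindex_bij_witness[of _ "\<lambda>k. k - j" "\<lambda>k. k + j"])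
              (auto simp: funpow_add)
          also have "\<dots> \<le> (\<Sum>k<n. indicator (B K) ((T ^^ k) x))"
            by (rule sum_mono2) auto
          finally show ?thesis unfolding l by (simp add: algebra_simps)
        qed
      qed
      have g_int: "integrable M (g n)" for n
        by (rule integrable_const_bound[of _ "real n"]) (use bound in \<open>auto intro!: AE_I2\<close>)
      have ind_int: "integrable M (\<lambda>x. indicat_real (B K) ((T ^^ k) x))" for k
        by (intro integrable_funpow) (simp add: emeasure_eq_measure)
      have "c * real n \<le> b * real n + real n * prob (B K) + real K" for n
      proof -
        have "c * real n \<le> (\<integral>x. g n x \<partial>M)" by (rule mean)
        also have "\<dots> \<le> (\<integral>x. b * real n + (\<Sum>k<n. indicator (B K) ((T ^^ k) x)) + real K \<partial>M)"
          by (intro integral_mono g_int le Bochner_Integration.integrable_add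
              Bochner_Integration.integrable_sum ind_int) auto
        also have "\<dots> = b * real n + (\<Sum>k<n. \<integral>x. indicat_real (B K) ((T ^^ k) x) \<partial>M) + real K"
          using ind_int by (simp add: prob_space)
        also have "(\<Sum>k<n. \<integral>x. indicat_real (B K) ((T ^^ k) x) \<partial>M) = real n * prob (B K)"
          by (subst integral_funpow) auto
        finally show ?thesis .
      qed
      then have "c \<le> b + prob (B K) + real K / real n" if "n > 0" for n
        using that by (simp add: field_simps)
      moreover have "(\<lambda>n. b + prob (B K) + real K / real n) \<longlonglongrightarrow> b + prob (B K) + 0"
        by (intro tendsto_intros lim_const_over_n)
      ultimately show ?thesis
        by (intro LIMSEQ_le_const[of _ "b + prob (B K)" c]) (auto intro!: exI[of _ 1])
    qed
    have "(\<lambda>K. prob (B K)) \<longlonglongrightarrow> prob (\<Inter>K. B K)"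
      by (rule finite_Lim_measure_decseq) (auto simp: B_def decseq_def)
    moreover have "prob (\<Inter>K. B K) = 0"
    proof -
      have "AE x in M. x \<notin> (\<Inter>K. B K)" using AE_A
      proof eventually_elim
        case (elim x)
        then have "\<exists>n. g n x - b * real n < - real 0" and xs: "x \<in> space M" unfolding A_def by blast+
        then obtain n where n: "g n x < b * real n" by auto
        then have "n \<noteq> 0" using bound[OF xs, of 0] by (intro notI) simp
        then have "x \<notin> B n" using n by (auto simp: B_def intro!: bexI[of _ n])
        then show ?case by auto
      qed
      then show ?thesis by (simp add: AE_iff_measurable[OF _ refl] prob_eq_0)
    qed
    ultimately have "(\<lambda>K. b + prob (B K)) \<longlonglongrightarrow> b + 0" by (intro tendsto_intros) auto
    then have "c \<le> b + 0" by (rule LIMSEQ_le_const) (use mean_le in auto)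
    then show False using \<open>b < c\<close> by simp
  qed
  ultimately have "prob A = 0" by simp
  then have "AE x in M. x \<notin> A" by (simp add: AE_iff_measurable[OF _ refl] prob_eq_0)
  then show ?thesis using A_iff by (auto elim: AE_mp)
qed

lemma bounded_subadditive_ergodic:
  fixes g :: "nat \<Rightarrow> 'a \<Rightarrow> real"
  assumes [measurable]: "\<And>n. g n \<in> borel_measurable M"
    and sub: "\<And>n k x. x \<in> space M \<Longrightarrow> g (n + k) x \<le> g n x + g k ((T ^^ n) x)"
    and bound: "\<And>n x. x \<in> space M \<Longrightarrow> 0 \<le> g n x \<and> g n x \<le> real n"
  defines "c \<equiv> INF n\<in>{1..}. (\<integral>x. g n x \<partial>M) / real n"
  assumes c: "0 < c"
  shows "AE x in M. (\<lambda>n. g n x / real n) \<longlonglongrightarrow> c"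
proof -
  have g_int: "integrable M (g n)" for n
    by (rule integrable_const_bound[of _ "real n"]) (use bound in \<open>auto intro!: AE_I2\<close>)
  have nn: "0 \<le> (\<integral>x. g n x \<partial>M)" for n
    by (rule integral_nonneg_AE) (use bound in auto)
  then have bdd: "bdd_below ((\<lambda>n. (\<integral>x. g n x \<partial>M) / real n) ` {1..})"
    by (auto intro!: bdd_belowI[of _ 0])
  have mean: "c * real n \<le> (\<integral>x. g n x \<partial>M)" for n
  proof (cases "n = 0")
    case False
    then have "c \<le> (\<integral>x. g n x \<partial>M) / real n"
      unfolding c_def by (intro cINF_lower[OF bdd]) auto
    then show ?thesis using False by (simp add: field_simps)
  qed (use nn in auto)
  \<comment> \<open>Countably many slopes on each side of \<open>c\<close> suffice for convergence.
    Taking them as \<open>c\<close> times \<open>1 - 1 / (j + 1)\<close> and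
    \<open>1 + 1 / (j + 1)\<close> keeps the lower ones nonnegative and, as \<open>c > 0\<close>,
    all of them different from \<open>c\<close>.\<close>
  have "AE x in M. \<forall>j::nat. bdd_below (range (\<lambda>n. g n x - (c - c / real (Suc j)) * real n))"
  proof (subst AE_all_countable, intro allI)
    fix j
    have "0 \<le> c - c / real (Suc j)" using c by (simp add: field_simps)
    then show "AE x in M. bdd_below (range (\<lambda>n. g n x - (c - c / real (Suc j)) * real n))"
      by (intro bounded_subadditive_AE_bdd_below[where c = c] sub bound mean) (use c in auto)
  qed
  moreover have "AE x in M. \<forall>j::nat. bdd_above (range (\<lambda>n. g n x - (c + c / real (Suc j)) * real n))"
  proof (subst AE_all_countable, intro allI)
    fix j
    define d where "d = c + c / real (Suc j)"
    have "c < d" using c by (simp add: d_def)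
    then obtain N where N: "N \<ge> 1" "(\<integral>x. g N x \<partial>M) / real N < d"
      unfolding c_def by (subst (asm) cINF_less_iff[OF _ bdd]) auto
    show "AE x in M. bdd_above (range (\<lambda>n. g n x - d * real n))"
    proof (rule subadditive_AE_bdd_above[of _ N])
      show "g (n + k) x - d * real (n + k) \<le> g n x - d * real n + (g k ((T ^^ n) x) - d * real k)"
        if "x \<in> space M" for n k x using sub[OF that, of n k] by (simp add: algebra_simps)
      show "(\<integral>x. g N x - d * real N \<partial>M) < 0" 
        using N g_int by (simp add: prob_space field_simps)
    qed (use g_int in auto)
  qed
  ultimately show ?thesis
  proof eventually_elim
    case (elim x)
    show ?case
    proof (rule LIMSEQ_I)
      fix r :: real assume r: "0 < r"
      obtain j :: nat where "2 * c / r < real j" using reals_Archimedean2 by blast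
      then have "2 * c < r * real (Suc j)" using r by (simp add: field_simps)
      then have j: "c / real (Suc j) < r / 2" by (simp add: field_simps)
      obtain C1 where C1: "\<And>n. C1 \<le> g n x - (c - c / real (Suc j)) * real n"
        using elim(1)[rule_format, of j] by (auto simp: bdd_below_def)
      obtain C2 where C2: "\<And>n. g n x - (c + c / real (Suc j)) * real n \<le> C2"
        using elim(2)[rule_format, of j] by (auto simp: bdd_above_def)
      define C where "C = max \<bar>C1\<bar> \<bar>C2\<bar>"
      obtain n0 :: nat where n0: "2 * C / r < real n0" using reals_Archimedean2 by blast
      have "norm (g n x / real n - c) < r" if n: "n \<ge> Suc n0" for n
      proof -
        have n': "0 < real n" using n by simp
        have rn: "C < r / 2 * real n" 
        proof -
          have "2 * C < r * real n0" using n0 r by (simp add: field_simps)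
          also have "\<dots> \<le> r * real n" using r n by (intro mult_left_mono) auto
          finally show ?thesis by simp
        qed
        have "c / real (Suc j) * real n < r / 2 * real n" using j n' by (rule mult_strict_right_mono)
        then have "\<bar>g n x - c * real n\<bar> < r * real n"
          using C1[of n] C2[of n] rn unfolding C_def left_diff_distrib distrib_right by linarith
        moreover have "g n x / real n - c = (g n x - c * real n) / real n" using n' by (simp add: field_simps)
        ultimately show ?thesis using n' by (simp add: abs_divide field_simps)
      qed
      then show "\<exists>no. \<forall>n\<ge>no. norm (g n x / real n - c) < r" by blast
    qed
  qed
qed

end

section \<open>The quenched noise and ergodicity of the joint shift\<close>

abbreviation noise_space :: "'d noise measure" where
  "noise_space \<equiv> \<Pi>\<^sub>M s\<in>UNIV. count_space UNIV"

primrec later :: "'d source \<Rightarrow> 'd source" where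
  "later (Immigrants n) = Immigrants (Suc n)"
| "later (Offspring n m i) = Offspring (Suc n) m i"

primrec source_time :: "'d source \<Rightarrow> nat" where
  "source_time (Immigrants n) = n"
| "source_time (Offspring n m i) = n"

definition noise_shift :: "'d noise \<Rightarrow> 'd noise" where
  "noise_shift x = (\<lambda>s. x (later s))"

text \<open>Stated through values rather than through a sub-sigma-algebra, so that it can be checked
  pathwise along the recursion; \<open>nn_integral_prod_indep\<close> converts it into
  independence.\<close>

definition depends_on :: "('d noise \<Rightarrow> 'b) \<Rightarrow> 'd source set \<Rightarrow> bool" where
  "depends_on f A \<longleftrightarrow> (\<forall>x y. (\<forall>s\<in>A. x s = y s) \<longrightarrow> f x = f y)"

lemma depends_onD: "depends_on f A \<Longrightarrow> (\<And>s. s \<in> A \<Longrightarrow> x s = y s) \<Longrightarrow> f x = f y"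
  by (auto simp: depends_on_def)

lemma depends_on_mono: "depends_on f A \<Longrightarrow> A \<subseteq> B \<Longrightarrow> depends_on f B"
  unfolding depends_on_def by (meson subsetD)

lemma depends_on_compose: "depends_on f A \<Longrightarrow> depends_on (\<lambda>x. h (f x)) A"
  unfolding depends_on_def by metis

lemma depends_on_indicator: "depends_on (\<lambda>x. x \<in> A) B \<Longrightarrow> depends_on (indicator A) B"
  unfolding indicator_def by (rule depends_on_compose)

lemma depends_on_compose2: "depends_on f A \<Longrightarrow> depends_on g A \<Longrightarrow> depends_on (\<lambda>x. h (f x) (g x)) A"
  unfolding depends_on_def by metis

lemma depends_on_UNIV: "depends_on f UNIV"
  unfolding depends_on_def by (metis UNIV_I ext)

lemma depends_on_coordinate: "s \<in> A \<Longrightarrow> depends_on (\<lambda>x. x s) A"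
  by (auto simp: depends_on_def)

lemma inj_later: "inj later"
proof (rule injI)
  fix s t :: "'d source" assume "later s = later t"
  then show "s = t" by (cases s; cases t) auto
qed

lemma space_noise_space [simp]: "space (noise_space :: 'd noise measure) = UNIV"
  by (simp add: space_PiM)

lemma noise_shift_funpow: "(noise_shift ^^ n) x s = x ((later ^^ n) s)"
  by (induction n arbitrary: s) (simp_all add: noise_shift_def funpow_swap1[of later])

lemma later_funpow [simp]:
  "(later ^^ n) (Immigrants k) = Immigrants (n + k)"
  "(later ^^ n) (Offspring k m i) = Offspring (n + k) m i"
  by (induction n) auto

lemma source_time_later_funpow [simp]: "source_time ((later ^^ n) s) = n + source_time s"
  by (cases s) auto

lemma depends_on_noise_shift:
  assumes "depends_on f A"
  shows "depends_on (\<lambda>x. f ((noise_shift ^^ n) x)) ((later ^^ n) ` A)"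
  unfolding depends_on_def
proof (intro allI impI)
  fix x y :: "'a noise" assume "\<forall>s\<in>(later ^^ n) ` A. x s = y s"
  then show "f ((noise_shift ^^ n) x) = f ((noise_shift ^^ n) y)"
    by (intro depends_onD[OF assms]) (auto simp: noise_shift_funpow)
qed

lemma noise_shift_measurable [measurable]: "noise_shift \<in> noise_space \<rightarrow>\<^sub>M noise_space"
  unfolding noise_shift_def by (rule measurable_PiM_single') (auto simp: space_PiM)

lemma noise_shift_funpow_measurable [measurable]: "noise_shift ^^ n \<in> noise_space \<rightarrow>\<^sub>M noise_space"
  by (induction n) (auto simp: id_def intro!: measurable_comp[OF _ noise_shift_measurable])

text \<open>\<open>nat ^ 'd\<close> is countable: with the population and the immigrants at time
  \<open>n\<close> frozen, the next generation is a finite sum of coordinates, and composing over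
  countably many values restores the random summation limits.\<close>

lemma branching_measurable [measurable]:
  fixes z :: "nat ^ 'd::finite"
  shows "(\<lambda>x. branching z x n) \<in> noise_space \<rightarrow>\<^sub>M count_space UNIV"
proof (induction n)
  case (Suc n)
  note [measurable] = Suc
  define F where "F k x = (\<Sum>i\<in>UNIV. \<Sum>m<k $ i + x (Immigrants n) $ i. x (Offspring n m i))" for k :: "nat^'d" and x :: "'d noise"
  define G where "G k l x = (\<Sum>i\<in>UNIV. \<Sum>m<k $ i + l $ i. x (Offspring n m i))" for k l :: "nat^'d" and x :: "'d noise"
  have sum_meas: "(\<lambda>x. \<Sum>i\<in>I. h i x) \<in> noise_space \<rightarrow>\<^sub>M count_space UNIV"
    if "finite I" "\<And>i. i \<in> I \<Longrightarrow> h i \<in> noise_space \<rightarrow>\<^sub>M count_space UNIV" for I :: "'i set" and h :: "'i \<Rightarrow> 'd noise \<Rightarrow> nat^'d"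
    using that
  proof (induction I rule: finite_induct)
    case (insert i I)
    have hi: "h i \<in> noise_space \<rightarrow>\<^sub>M count_space UNIV" using insert by auto
    have "(\<lambda>x. h i x + (\<Sum>i\<in>I. h i x)) \<in> noise_space \<rightarrow>\<^sub>M count_space UNIV"
      by (rule measurable_compose_countable[where f = "\<lambda>k x. h i x + k" and g = "\<lambda>x. \<Sum>i\<in>I. h i x"])
        (use insert in \<open>auto intro: measurable_compose[OF hi]\<close>)
    then show ?case using insert by simp
  qed simp
  have "G k l \<in> noise_space \<rightarrow>\<^sub>M count_space UNIV" for k l
    unfolding G_def by (intro sum_meas) auto
  then have "(\<lambda>x. G k (x (Immigrants n)) x) \<in> noise_space \<rightarrow>\<^sub>M count_space UNIV" for k
    by (intro measurable_compose_countable[where f = "\<lambda>l x. G k l x" and g = "\<lambda>x. x (Immigrants n)"]) auto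
  then have "(\<lambda>x. G (branching z x n) (x (Immigrants n)) x) \<in> noise_space \<rightarrow>\<^sub>M count_space UNIV"
    by (intro measurable_compose_countable[where f = "\<lambda>k x. G k (x (Immigrants n)) x" and g = "\<lambda>x. branching z x n"]) auto
  then show ?case by (simp add: G_def)
qed auto

lemma branching_depends_on: "depends_on (\<lambda>x. branching z x n) {s. source_time s < n}"
  unfolding depends_on_def
proof (intro allI impI)
  fix x y :: "'a noise" assume "\<forall>s\<in>{s. source_time s < n}. x s = y s"
  then show "branching z x n = branching z y n"
  proof (induction n)
    case (Suc n)
    then have "branching z x n = branching z y n" by auto
    moreover have "x (Immigrants n) = y (Immigrants n)" "x (Offspring n m i) = y (Offspring n m i)" for m i
      using Suc.prems by auto
    ultimately show ?case by simp
  qed auto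
qed

lemma branching_add:
  "branching z x (n + k) = branching (branching z x n) ((noise_shift ^^ n) x) k"
  by (induction k) (simp_all add: noise_shift_funpow)

text \<open>Pathwise coupling: both processes read the same noise, and in each type the particles of
  the smaller population are an initial segment of the numbering in the larger one.\<close>

lemma branching_mono:
  assumes "\<And>i. z $ i \<le> z' $ i"
  shows "branching z x n $ i \<le> branching z' x n $ i"
proof (induction n arbitrary: i)
  case (Suc n)
  show ?case by (simp, intro sum_mono sum_mono2) (auto intro: order_less_le_trans Suc)
qed (use assms in auto)

lemma branching_shift_le: "branching 0 ((noise_shift ^^ n) x) k $ i \<le> branching 0 x (n + k) $ i"
  unfolding branching_add by (rule branching_mono) auto

text \<open>Besides the subadditivity of the zero count, this yields, through stationarity, that the
  annealed probability of a zero is nonincreasing in time.\<close>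

lemma branching_shift_eq_0: "branching 0 x (n + k) = 0 \<Longrightarrow> branching 0 ((noise_shift ^^ n) x) k = 0"
  using branching_shift_le[of n x k] by (simp add: vec_eq_iff)

section \<open>The quenched law: coordinates, independence and conditioning\<close>

locale branching_environment =
  fixes S :: "'a measure" and P :: "(int \<Rightarrow> 'a) measure"
    and q :: "'a \<Rightarrow> (nat ^ 'd::finite) measure" and p :: "'d \<Rightarrow> 'a \<Rightarrow> (nat ^ 'd) measure"
  assumes env: "stationary_ergodic_env S P"
    and q_meas [measurable]: "q \<in> S \<rightarrow>\<^sub>M prob_algebra (count_space UNIV)"
    and p_meas [measurable]: "\<And>i. p i \<in> S \<rightarrow>\<^sub>M prob_algebra (count_space UNIV)"
begin

abbreviation "Q \<equiv> quenched q p"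
abbreviation "\<AA> \<equiv> annealed q p P"

lemma sets_P [measurable_cong]: "sets P = sets (\<Pi>\<^sub>M n\<in>(UNIV::int set). S)"
  using env by (simp add: stationary_ergodic_env_def)

lemma prob_space_P: "prob_space P"
  using env by (simp add: stationary_ergodic_env_def)

lemma env_shift_measurable [measurable]: "env_shift \<in> P \<rightarrow>\<^sub>M P"
proof -
  have "env_shift \<in> (\<Pi>\<^sub>M n\<in>(UNIV::int set). S) \<rightarrow>\<^sub>M (\<Pi>\<^sub>M n\<in>(UNIV::int set). S)"
    unfolding env_shift_def by (rule measurable_PiM_single') (auto simp: space_PiM PiE_iff)
  then show ?thesis by (simp add: measurable_cong_sets[OF sets_P sets_P])
qed

lemma env_ergodic: "ergodic_system P env_shift"
  using env unfolding stationary_ergodic_env_def ergodic_system_def ergodic_system_axioms_def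
    stationary_env_def ergodic_env_def by auto

sublocale E: ergodic_system P env_shift by (rule env_ergodic)

lemma env_shift_space: "\<omega> \<in> space P \<Longrightarrow> (env_shift ^^ n) \<omega> \<in> space P"
  by (rule measurable_space[OF E.funpow_meas])

lemma source_law_measurable [measurable]:
  "(\<lambda>\<omega>. source_law q p \<omega> s) \<in> P \<rightarrow>\<^sub>M prob_algebra (count_space UNIV)"
  by (cases s) simp_all

lemma quenched_measurable' [measurable]: "Q \<in> P \<rightarrow>\<^sub>M prob_algebra noise_space"
  by (rule quenched_measurable[OF sets_P q_meas p_meas])

lemma quenched_measurable_subprob [measurable]: "Q \<in> P \<rightarrow>\<^sub>M subprob_algebra noise_space"
  by (rule measurable_prob_algebraD) measurable

lemma source_law_later: "source_law q p \<omega> (later s) = source_law q p (env_shift \<omega>) s"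
  by (cases s) (auto simp: env_shift_def algebra_simps)

lemma prob_space_annealed': "prob_space \<AA>"
  by (rule prob_space_annealed[OF prob_space_P sets_P q_meas p_meas])

lemma sets_annealed: "sets \<AA> = sets (P \<Otimes>\<^sub>M noise_space)"
proof -
  let ?K = "\<lambda>\<omega>. distr (Q \<omega>) (P \<Otimes>\<^sub>M noise_space) (Pair \<omega>)"
  have "?K \<in> P \<rightarrow>\<^sub>M prob_algebra (P \<Otimes>\<^sub>M noise_space)"
    by (rule measurable_distr_prob_space2[where M="noise_space"]) measurable
  then show ?thesis unfolding annealed_def
    using prob_space.not_empty[OF prob_space_P]
    by (intro sets_bind) auto
qed

lemma space_annealed: "space \<AA> = space P \<times> UNIV"
  using sets_eq_imp_space_eq[OF sets_annealed] by (simp add: space_pair_measure)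

lemma emeasure_annealed':
  "C \<in> sets \<AA> \<Longrightarrow> emeasure \<AA> C = (\<integral>\<^sup>+\<omega>. emeasure (Q \<omega>) (Pair \<omega> -` C) \<partial>P)"
  by (rule emeasure_annealed[OF prob_space_P sets_P q_meas p_meas]) (simp add: sets_annealed)

context
  fixes \<omega> :: "int \<Rightarrow> 'a"
  assumes \<omega>: "\<omega> \<in> space P"
begin

lemma prob_space_source_law: "prob_space (source_law q p \<omega> s)"
  and sets_source_law: "sets (source_law q p \<omega> s) = UNIV"
  using measurable_space[OF source_law_measurable \<omega>, of s] by (auto simp: space_prob_algebra)

lemma prob_space_quenched: "prob_space (Q \<omega>)"
  and sets_quenched: "sets (Q \<omega>) = sets noise_space"
  using measurable_space[OF quenched_measurable' \<omega>] by (auto simp: space_prob_algebra)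

lemma space_quenched [simp]: "space (Q \<omega>) = UNIV"
  using sets_eq_imp_space_eq[OF sets_quenched] by simp

lemma measurable_quenched: "measurable (Q \<omega>) N = measurable noise_space N"
  by (rule measurable_cong_sets[OF sets_quenched refl])

lemma distr_coordinate: "distr (Q \<omega>) (count_space UNIV) (\<lambda>x. x s) = source_law q p \<omega> s"
proof -
  have "distr (Q \<omega>) (count_space UNIV) (\<lambda>x. x s) = distr (Q \<omega>) (source_law q p \<omega> s) (\<lambda>x. x s)"
    by (rule distr_cong) (auto simp: sets_source_law)
  also have "\<dots> = source_law q p \<omega> s"
    unfolding quenched_def by (rule distr_PiM_component) (auto intro: prob_space_source_law)
  finally show ?thesis .
qed

lemma nn_integral_coordinate:
  "(\<integral>\<^sup>+x. f (x s) \<partial>Q \<omega>) = (\<integral>\<^sup>+y. f y \<partial>source_law q p \<omega> s)"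
proof -
  have "(\<integral>\<^sup>+y. f y \<partial>distr (Q \<omega>) (count_space UNIV) (\<lambda>x. x s)) = (\<integral>\<^sup>+x. f (x s) \<partial>Q \<omega>)"
    by (rule nn_integral_distr) (auto simp: measurable_quenched)
  then show ?thesis by (simp add: distr_coordinate)
qed

text \<open>The noise read through the injective map \<open>later\<close> has a product law, the
  corresponding marginal of \<open>Q \<omega>\<close>, and by \<open>source_law_later\<close> its
  factors are those of the shifted environment.\<close>

lemma quenched_noise_shift: "distr (Q \<omega>) noise_space noise_shift = Q (env_shift \<omega>)"
proof -
  have "distr (Q \<omega>) (\<Pi>\<^sub>M i\<in>UNIV. source_law q p \<omega> (later i)) (\<lambda>x. \<lambda>n\<in>UNIV. x (later n))
    = (\<Pi>\<^sub>M i\<in>UNIV. source_law q p \<omega> (later i))"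
    unfolding quenched_def
    by (rule distr_PiM_reindex) (auto intro: prob_space_source_law inj_later)
  moreover have "sets (\<Pi>\<^sub>M i\<in>UNIV. source_law q p \<omega> (later i)) = sets noise_space"
    by (intro sets_PiM_cong) (auto simp: sets_source_law)
  then have "distr (Q \<omega>) (\<Pi>\<^sub>M i\<in>UNIV. source_law q p \<omega> (later i)) (\<lambda>x. \<lambda>n\<in>UNIV. x (later n))
    = distr (Q \<omega>) noise_space noise_shift"
    by (intro distr_cong) (auto simp: noise_shift_def)
  ultimately show ?thesis
    by (simp add: source_law_later quenched_def)
qed

lemma indep_vars_coordinates:
  "prob_space.indep_vars (Q \<omega>) (\<lambda>_. count_space UNIV) (\<lambda>s x. x s) UNIV"
proof -
  interpret prob_space "Q \<omega>" by (rule prob_space_quenched)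
  have "distr (Q \<omega>) noise_space (\<lambda>x. \<lambda>i\<in>UNIV. x i) = distr (Q \<omega>) (Q \<omega>) (\<lambda>x. x)"
    by (rule distr_cong) (auto simp: sets_quenched)
  also have "\<dots> = (\<Pi>\<^sub>M i\<in>UNIV. distr (Q \<omega>) (count_space UNIV) (\<lambda>x. x i))"
    unfolding distr_id distr_coordinate by (simp add: quenched_def)
  finally show ?thesis
    by (subst indep_vars_iff_distr_eq_PiM) (auto simp: measurable_quenched)
qed

lemma nn_integral_prod_indep:
  fixes f :: "'j \<Rightarrow> 'd noise \<Rightarrow> ennreal"
  assumes L: "finite L" and dep: "\<And>j. j \<in> L \<Longrightarrow> depends_on (f j) (K j)"
    and disj: "disjoint_family_on K L"
    and meas: "\<And>j. j \<in> L \<Longrightarrow> f j \<in> borel_measurable noise_space"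
  shows "(\<integral>\<^sup>+x. (\<Prod>j\<in>L. f j x) \<partial>Q \<omega>) = (\<Prod>j\<in>L. \<integral>\<^sup>+x. f j x \<partial>Q \<omega>)"
proof -
  interpret prob_space "Q \<omega>" by (rule prob_space_quenched)
  \<comment> \<open>Filling the coordinates outside \<open>K j\<close> with 0 produces a function of
    the restriction to \<open>K j\<close> alone, and \<open>depends_on\<close> guarantees that the
    value of \<open>f j\<close> is unchanged.\<close>
  define g where "g j y = f j (\<lambda>s. if s \<in> K j then y s else 0)" for j y
  have gf: "g j (restrict x (K j)) = f j x" if "j \<in> L" for j x
    unfolding g_def by (rule depends_onD[OF dep[OF that]]) auto
  have "indep_vars (\<lambda>j. PiM (K j) (\<lambda>_. count_space UNIV)) (\<lambda>j x. restrict (\<lambda>s. x s) (K j)) L"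
    by (rule indep_vars_restrict[OF indep_vars_coordinates _ disj]) auto
  then have "indep_vars (\<lambda>_. borel) (\<lambda>j x. g j (restrict (\<lambda>s. x s) (K j))) L"
  proof (rule indep_vars_compose2)
    fix j assume j: "j \<in> L"
    have "(\<lambda>y s. if s \<in> K j then y s else 0) \<in> PiM (K j) (\<lambda>_. count_space UNIV) \<rightarrow>\<^sub>M (noise_space :: 'd noise measure)"
    proof (rule measurable_PiM_single')
      fix s show "(\<lambda>y. if s \<in> K j then y s else 0) \<in> PiM (K j) (\<lambda>_. count_space UNIV) \<rightarrow>\<^sub>M count_space UNIV"
        by (cases "s \<in> K j") auto
    qed auto
    then show "g j \<in> PiM (K j) (\<lambda>_. count_space UNIV) \<rightarrow>\<^sub>M borel"
      unfolding g_def using meas[OF j] by (rule measurable_compose)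
  qed
  then have "indep_vars (\<lambda>_. borel) f L"
    by (rule indep_vars_cong[THEN iffD1, rotated -1]) (auto simp: gf)
  then show ?thesis using L by (intro indep_vars_nn_integral) auto
qed

lemma nn_integral_mult_indep:
  fixes f g :: "'d noise \<Rightarrow> ennreal"
  assumes "depends_on f A" "depends_on g B" "A \<inter> B = {}"
    and "f \<in> borel_measurable noise_space" "g \<in> borel_measurable noise_space"
  shows "(\<integral>\<^sup>+x. f x * g x \<partial>Q \<omega>) = (\<integral>\<^sup>+x. f x \<partial>Q \<omega>) * (\<integral>\<^sup>+x. g x \<partial>Q \<omega>)"
proof -
  have "(\<integral>\<^sup>+x. (\<Prod>j\<in>UNIV. case_bool f g j x) \<partial>Q \<omega>) = (\<Prod>j\<in>UNIV. \<integral>\<^sup>+x. case_bool f g j x \<partial>Q \<omega>)"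
    by (rule nn_integral_prod_indep[where K = "case_bool A B"])
      (use assms in \<open>auto simp: disjoint_family_on_def split: bool.split\<close>)
  then show ?thesis by (simp add: UNIV_bool mult.commute)
qed

text \<open>Conditioning on a countably valued \<open>W\<close> without conditional expectations:
  split over its values, factor each term by independence, and sum again. It evaluates sums and
  products with random numbers of terms.\<close>

lemma nn_integral_freeze:
  fixes \<Phi> :: "'b::countable \<Rightarrow> 'd noise \<Rightarrow> ennreal"
  assumes W: "depends_on W A" and W_meas [measurable]: "W \<in> noise_space \<rightarrow>\<^sub>M count_space UNIV"
    and dep: "\<And>k. depends_on (\<Phi> k) B" and AB: "A \<inter> B = {}"
    and [measurable]: "\<And>k. \<Phi> k \<in> borel_measurable noise_space"
  shows "(\<integral>\<^sup>+x. \<Phi> (W x) x \<partial>Q \<omega>) = (\<integral>\<^sup>+x. (\<integral>\<^sup>+y. \<Phi> (W x) y \<partial>Q \<omega>) \<partial>Q \<omega>)"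
proof -
  note [simp] = measurable_quenched
  define ind :: "nat \<Rightarrow> 'd noise \<Rightarrow> ennreal" where "ind n x = (if to_nat (W x) = n then 1 else 0)" for n x
  have [measurable]: "ind n \<in> borel_measurable noise_space" for n
    unfolding ind_def by (rule measurable_compose[OF W_meas]) auto
  \<comment> \<open>Only \<open>n = to_nat (W x)\<close> has a nonzero weight, and there
    \<open>from_nat n\<close> is \<open>W x\<close>; other values of \<open>from_nat\<close> do no
    harm.\<close>
  have split: "(\<Sum>n. ind n x * c (from_nat n)) = c (W x)" for c :: "'b \<Rightarrow> ennreal" and x
  proof -
    have "(\<lambda>n. ind n x * c (from_nat n)) sums (\<Sum>n\<in>{to_nat (W x)}. ind n x * c (from_nat n))"
      by (rule sums_finite) (auto simp: ind_def)
    then show ?thesis by (simp add: ind_def sums_iff)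
  qed
  have "(\<integral>\<^sup>+x. \<Phi> (W x) x \<partial>Q \<omega>) = (\<integral>\<^sup>+x. (\<Sum>n. ind n x * \<Phi> (from_nat n) x) \<partial>Q \<omega>)"
    using split[of x "\<lambda>k. \<Phi> k x" for x] by simp
  also have "\<dots> = (\<Sum>n. \<integral>\<^sup>+x. ind n x * \<Phi> (from_nat n) x \<partial>Q \<omega>)"
    by (rule nn_integral_suminf) simp
  also have "\<dots> = (\<Sum>n. (\<integral>\<^sup>+x. ind n x \<partial>Q \<omega>) * (\<integral>\<^sup>+y. \<Phi> (from_nat n) y \<partial>Q \<omega>))"
    by (intro suminf_cong nn_integral_mult_indep[of _ A _ B])
      (auto simp: ind_def intro!: dep AB depends_on_compose[OF W])
  also have "\<dots> = (\<Sum>n. \<integral>\<^sup>+x. ind n x * (\<integral>\<^sup>+y. \<Phi> (from_nat n) y \<partial>Q \<omega>) \<partial>Q \<omega>)"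
    by (subst nn_integral_multc) auto
  also have "\<dots> = (\<integral>\<^sup>+x. (\<Sum>n. ind n x * (\<integral>\<^sup>+y. \<Phi> (from_nat n) y \<partial>Q \<omega>)) \<partial>Q \<omega>)"
    by (rule nn_integral_suminf[symmetric]) simp
  also have "\<dots> = (\<integral>\<^sup>+x. (\<integral>\<^sup>+y. \<Phi> (W x) y \<partial>Q \<omega>) \<partial>Q \<omega>)"
    using split[of _ "\<lambda>k. \<integral>\<^sup>+y. \<Phi> k y \<partial>Q \<omega>"] by simp
  finally show ?thesis .
qed

text \<open>Kolmogorov's zero-one law, with the tail taken in time because every time level carries
  infinitely many coordinates. \<open>X\<close> is independent of each finite cylinder, hence of the
  generated sigma-algebra, hence of itself.\<close>

lemma quenched_zero_one:
  assumes X: "X \<in> sets noise_space"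
    and tail: "\<And>n. depends_on (\<lambda>x. x \<in> X) {s. n \<le> source_time s}"
  shows "emeasure (Q \<omega>) X = 0 \<or> emeasure (Q \<omega>) X = 1"
proof -
  interpret prob_space "Q \<omega>" by (rule prob_space_quenched)
  let ?G = "prod_algebra UNIV (\<lambda>_ :: 'd source. count_space (UNIV :: (nat ^ 'd) set))"
  have G_sets: "?G \<subseteq> events" unfolding sets_quenched sets_PiM by auto
  have "indep_set ?G {X}"
    unfolding indep_sets2_eq
  proof (intro conjI ballI)
    show "?G \<subseteq> events" by (rule G_sets)
    show "{X} \<subseteq> events" using X sets_quenched by auto
    fix D X' assume D: "D \<in> ?G" and "X' \<in> {X}"
    then have [simp]: "X' = X" by simp
    from D obtain J F where D_eq: "D = prod_emb UNIV (\<lambda>_. count_space UNIV) J (Pi\<^sub>E J F)" and J: "finite J"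
      by (elim prod_algebraE) auto
    \<comment> \<open>A time beyond all coordinates of the cylinder; the inserted 0 covers an empty
      \<open>J\<close>.\<close>
    define n where "n = Suc (Max (insert 0 (source_time ` J)))"
    have less: "source_time s < n" if "s \<in> J" for s
      unfolding n_def using J that by (auto simp: less_Suc_eq_le)
    have D_dep: "depends_on (\<lambda>x. x \<in> D) J"
      unfolding depends_on_def D_eq prod_emb_def by (auto simp: PiE_iff)
    have DN: "D \<in> sets noise_space" using D G_sets sets_quenched by auto
    have "(\<integral>\<^sup>+x. indicator D x * indicator X x \<partial>Q \<omega>) = (\<integral>\<^sup>+x. indicator D x \<partial>Q \<omega>) * (\<integral>\<^sup>+x. indicator X x \<partial>Q \<omega>)"
      using D_dep tail[of n] less DN X
      by (intro nn_integral_mult_indep[of _ J _ "{s. n \<le> source_time s}"])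
        (auto simp: indicator_def of_bool_def not_le[symmetric] intro: depends_on_compose[where h = "\<lambda>b. if b then 1 else 0"])
    then have "emeasure (Q \<omega>) (D \<inter> X) = emeasure (Q \<omega>) D * emeasure (Q \<omega>) X"
      using DN X sets_quenched by (simp add: indicator_inter_arith[symmetric])
    then show "prob (D \<inter> X') = prob D * prob X'"
      by (simp add: emeasure_eq_measure ennreal_mult'[symmetric] measure_nonneg)
  qed
  then have "indep_set (sigma_sets (space (Q \<omega>)) ?G) (sigma_sets (space (Q \<omega>)) {X})"
    by (rule indep_set_sigma_sets[OF _ Int_stable_prod_algebra]) (auto simp: Int_stable_def)
  moreover have "X \<in> sigma_sets (space (Q \<omega>)) ?G"
    using X unfolding sets_PiM by (simp add: space_PiM)
  ultimately have "prob (X \<inter> X) = prob X * prob X"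
    unfolding indep_sets2_eq by blast
  then have "prob X = 0 \<or> prob X = 1" by simp
  then show ?thesis by (auto simp: emeasure_eq_measure)
qed

end

section \<open>The joint shift of environment and noise\<close>

definition joint_shift :: "(int \<Rightarrow> 'a) \<times> 'd noise \<Rightarrow> (int \<Rightarrow> 'a) \<times> 'd noise" where
  "joint_shift = (\<lambda>(\<omega>, x). (env_shift \<omega>, noise_shift x))"

lemma joint_shift_funpow: "(joint_shift ^^ n) (\<omega>, x) = ((env_shift ^^ n) \<omega>, (noise_shift ^^ n) x)"
  by (induction n) (auto simp: joint_shift_def)

lemma joint_shift_measurable [measurable]: "joint_shift \<in> \<AA> \<rightarrow>\<^sub>M \<AA>"
proof -
  have "joint_shift \<in> P \<Otimes>\<^sub>M noise_space \<rightarrow>\<^sub>M P \<Otimes>\<^sub>M noise_space"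
    unfolding joint_shift_def by measurable
  then show ?thesis by (simp add: measurable_cong_sets[OF sets_annealed sets_annealed])
qed

lemma section_sets: "C \<in> sets \<AA> \<Longrightarrow> Pair \<omega> -` C \<in> sets noise_space"
  unfolding sets_annealed by (rule sets_Pair1)

lemma quenched_section_shift:
  assumes C: "C \<in> sets \<AA>" and \<omega>: "\<omega> \<in> space P"
  shows "emeasure (Q \<omega>) {x. (env_shift \<omega>, noise_shift x) \<in> C} = emeasure (Q (env_shift \<omega>)) (Pair (env_shift \<omega>) -` C)"
proof -
  have "emeasure (distr (Q \<omega>) noise_space noise_shift) (Pair (env_shift \<omega>) -` C)
      = emeasure (Q \<omega>) (noise_shift -` (Pair (env_shift \<omega>) -` C) \<inter> space (Q \<omega>))"
    by (rule emeasure_distr) (auto simp: measurable_quenched[OF \<omega>] section_sets[OF C])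
  then show ?thesis using quenched_noise_shift[OF \<omega>] \<omega> by (simp add: vimage_def)
qed

lemma emeasure_section_measurable:
  assumes "C \<in> sets \<AA>"
  shows "(\<lambda>\<omega>. emeasure (Q \<omega>) (Pair \<omega> -` C)) \<in> borel_measurable P"
proof (rule emeasure_measurable_subprob_algebra2[OF _ quenched_measurable_subprob])
  have "Sigma (space P) (\<lambda>\<omega>. Pair \<omega> -` C) = C"
    using sets.sets_into_space[OF assms] by (auto simp: space_annealed)
  then show "Sigma (space P) (\<lambda>\<omega>. Pair \<omega> -` C) \<in> sets (P \<Otimes>\<^sub>M noise_space)"
    using assms by (simp add: sets_annealed)
qed

lemma joint_shift_preserving: "distr \<AA> \<AA> joint_shift = \<AA>"
proof (rule measure_eqI)
  fix C assume "C \<in> sets (distr \<AA> \<AA> joint_shift)"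
  then have C: "C \<in> sets \<AA>" by simp
  have "emeasure (distr \<AA> \<AA> joint_shift) C = emeasure \<AA> (joint_shift -` C \<inter> space \<AA>)"
    by (rule emeasure_distr) (auto simp: C)
  also have "\<dots> = (\<integral>\<^sup>+\<omega>. emeasure (Q \<omega>) (Pair \<omega> -` (joint_shift -` C \<inter> space \<AA>)) \<partial>P)"
    by (rule emeasure_annealed') (use C in measurable)
  also have "\<dots> = (\<integral>\<^sup>+\<omega>. emeasure (Q (env_shift \<omega>)) (Pair (env_shift \<omega>) -` C) \<partial>P)"
  proof (rule nn_integral_cong)
    fix \<omega> assume \<omega>: "\<omega> \<in> space P"
    have "Pair \<omega> -` (joint_shift -` C \<inter> space \<AA>) = {x. (env_shift \<omega>, noise_shift x) \<in> C}"
      using \<omega> by (auto simp: joint_shift_def space_annealed)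
    then show "emeasure (Q \<omega>) (Pair \<omega> -` (joint_shift -` C \<inter> space \<AA>)) = emeasure (Q (env_shift \<omega>)) (Pair (env_shift \<omega>) -` C)"
      using quenched_section_shift[OF C \<omega>] by simp
  qed
  also have "\<dots> = (\<integral>\<^sup>+\<omega>. emeasure (Q \<omega>) (Pair \<omega> -` C) \<partial>distr P P env_shift)"
    by (rule nn_integral_distr[symmetric]) (auto simp: emeasure_section_measurable[OF C])
  also have "\<dots> = emeasure \<AA> C"
    unfolding E.T_preserving by (rule emeasure_annealed'[OF C, symmetric])
  finally show "emeasure (distr \<AA> \<AA> joint_shift) C = emeasure \<AA> C" .
qed simp

text \<open>
  The sections of an invariant set are tail events of the noise, so their quenched probabilities
  are 0 or 1; the environments for which they are 1 form an invariant set.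
\<close>

lemma annealed_ergodic: "ergodic_system \<AA> joint_shift"
proof -
  interpret A: prob_space \<AA> by (rule prob_space_annealed')
  have "A.prob C = 0 \<or> A.prob C = 1"
    if C: "C \<in> sets \<AA>" and inv: "joint_shift -` C \<inter> space \<AA> = C" for C
  proof -
    define g where "g \<omega> = emeasure (Q \<omega>) (Pair \<omega> -` C)" for \<omega>
    have [measurable]: "g \<in> borel_measurable P"
      unfolding g_def by (rule emeasure_section_measurable[OF C])
    have inv1: "(env_shift \<omega>, noise_shift x) \<in> C \<longleftrightarrow> (\<omega>, x) \<in> C" if "\<omega> \<in> space P" for \<omega> x
      using inv that by (auto simp: joint_shift_def space_annealed)
    have invn: "((env_shift ^^ n) \<omega>, (noise_shift ^^ n) x) \<in> C \<longleftrightarrow> (\<omega>, x) \<in> C" if "\<omega> \<in> space P" for \<omega> x n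
      by (induction n) (auto simp: inv1 env_shift_space that)
    have g01: "g \<omega> = 0 \<or> g \<omega> = 1" if \<omega>: "\<omega> \<in> space P" for \<omega>
      unfolding g_def
    proof (rule quenched_zero_one[OF \<omega> section_sets[OF C]])
      fix n
      \<comment> \<open>By invariance, membership in \<open>C\<close> can be tested after
        \<open>n\<close> shifts, and the shifted noise reads only sources at times from
        \<open>n\<close> on.\<close>
      have "depends_on (\<lambda>x. ((env_shift ^^ n) \<omega>, (noise_shift ^^ n) x) \<in> C) ((later ^^ n) ` UNIV)"
        by (rule depends_on_noise_shift) (rule depends_on_UNIV)
      then have "depends_on (\<lambda>x. ((env_shift ^^ n) \<omega>, (noise_shift ^^ n) x) \<in> C) {s. n \<le> source_time s}"
        by (rule depends_on_mono) auto
      then show "depends_on (\<lambda>x. x \<in> Pair \<omega> -` C) {s. n \<le> source_time s}"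
        by (simp add: invn[OF \<omega>])
    qed
    define G where "G = {\<omega> \<in> space P. g \<omega> = 1}"
    have [measurable]: "G \<in> sets P" unfolding G_def by measurable
    have g_shift: "g (env_shift \<omega>) = g \<omega>" if "\<omega> \<in> space P" for \<omega>
      unfolding g_def quenched_section_shift[OF C that, symmetric] by (simp add: inv1[OF that] vimage_def)
    have "env_shift -` G \<inter> space P = G"
      using measurable_space[OF env_shift_measurable] by (auto simp: G_def g_shift)
    then have "E.prob G = 0 \<or> E.prob G = 1" by (intro E.T_ergodic) auto
    moreover have "emeasure \<AA> C = emeasure P G"
    proof -
      have "emeasure \<AA> C = (\<integral>\<^sup>+\<omega>. g \<omega> \<partial>P)" unfolding g_def by (rule emeasure_annealed'[OF C])
      also have "\<dots> = (\<integral>\<^sup>+\<omega>. indicator G \<omega> \<partial>P)"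
        using g01 by (intro nn_integral_cong) (auto simp: G_def indicator_def)
      finally show ?thesis by simp
    qed
    ultimately show ?thesis by (simp add: measure_def)
  qed
  then show ?thesis
    by unfold_locales (auto simp: joint_shift_preserving)
qed

sublocale A: ergodic_system \<AA> joint_shift by (rule annealed_ergodic)

end

section \<open>Quenched generating functions and means\<close>

text \<open>The monomial of a multivariate generating function. Values in \<open>ennreal\<close>
  spare integrability conditions, and \<open>0 ^ 0 = 1\<close> turns the case \<open>s = 0\<close>
  into the indicator of \<open>k = 0\<close>.\<close>

definition vec_power :: "('d::finite \<Rightarrow> ennreal) \<Rightarrow> nat ^ 'd \<Rightarrow> ennreal" where
  "vec_power s k = (\<Prod>i\<in>UNIV. s i ^ (k $ i))"

lemma vec_power_add: "vec_power s (k + l) = vec_power s k * vec_power s l"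
  by (simp add: vec_power_def power_add prod.distrib)

lemma vec_power_sum: "finite I \<Longrightarrow> vec_power s (\<Sum>i\<in>I. f i) = (\<Prod>i\<in>I. vec_power s (f i))"
  by (induction I rule: finite_induct) (simp_all add: vec_power_add, simp add: vec_power_def)

lemma vec_power_0: "vec_power (\<lambda>_. 0) k = (if k = 0 then 1 else 0)"
  by (auto simp: vec_power_def vec_eq_iff power_0_left)

context branching_environment
begin

lemma source_law_later_funpow: "source_law q p \<omega> ((later ^^ n) s) = source_law q p ((env_shift ^^ n) \<omega>) s"
proof (induction n arbitrary: \<omega>)
  case (Suc n)
  have "source_law q p \<omega> ((later ^^ Suc n) s) = source_law q p (env_shift \<omega>) ((later ^^ n) s)"
    by (simp add: source_law_later)
  then show ?case by (simp add: Suc funpow_swap1)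
qed simp

abbreviation coord_mean :: "(int \<Rightarrow> 'a) \<Rightarrow> 'd source \<Rightarrow> 'd \<Rightarrow> ennreal" where
  "coord_mean \<omega> s j \<equiv> \<integral>\<^sup>+y. of_nat (y $ j) \<partial>source_law q p \<omega> s"

lemma coord_mean_measurable [measurable]: "(\<lambda>\<omega>. coord_mean \<omega> s j) \<in> borel_measurable P"
  by (rule nn_integral_measurable_subprob_algebra2[where N = "count_space UNIV"])
    (auto intro!: measurable_prob_algebraD)

context
  fixes \<omega> :: "int \<Rightarrow> 'a"
  assumes \<omega>: "\<omega> \<in> space P"
begin

lemmas [simp] = measurable_quenched[OF \<omega>] space_quenched[OF \<omega>]

lemma quenched_shift_funpow: "distr (Q \<omega>) noise_space (noise_shift ^^ n) = Q ((env_shift ^^ n) \<omega>)"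
proof (induction n)
  case 0
  then show ?case using distr_id2[OF sets_quenched[OF \<omega>, symmetric]] by (simp add: id_def)
next
  case (Suc n)
  have "distr (Q \<omega>) noise_space (noise_shift ^^ Suc n) = distr (distr (Q \<omega>) noise_space (noise_shift ^^ n)) noise_space noise_shift"
    by (subst distr_distr) (auto simp: comp_def)
  then show ?case
    using Suc quenched_noise_shift[OF env_shift_space[OF \<omega>, of n]] by (simp add: comp_def)
qed

text \<open>The last generation is peeled off: given the population and the immigrants at time
  \<open>n\<close>, the integral is the monomial of their sum with \<open>s\<close> replaced by
  \<open>f\<close>. Hence the induction over arbitrary \<open>s\<close>; the independent immigrants
  contribute the factor \<open>g\<close>, which is free of \<open>z\<close>.\<close>

lemma generating_function:
  "\<exists>F G. \<forall>z. (\<integral>\<^sup>+x. vec_power s (branching z x n) \<partial>Q \<omega>) = vec_power F z * G"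
proof (induction n arbitrary: s)
  case 0
  show ?case
    using prob_space.emeasure_space_1[OF prob_space_quenched[OF \<omega>]]
    by (intro exI[of _ s] exI[of _ 1]) simp
next
  case (Suc n)
  define f where "f i = (\<integral>\<^sup>+y. vec_power s y \<partial>source_law q p \<omega> (Offspring n 0 i))" for i
  obtain F G where FG: "\<And>z. (\<integral>\<^sup>+x. vec_power f (branching z x n) \<partial>Q \<omega>) = vec_power F z * G"
    using Suc by metis
  define g where "g = (\<integral>\<^sup>+x. vec_power f (x (Immigrants n)) \<partial>Q \<omega>)"
  define \<Phi> where "\<Phi> k x = (\<Prod>(i, m)\<in>(SIGMA i:UNIV. {..<k $ i}). vec_power s (x (Offspring n m i)))" for k and x :: "'d noise"
  have \<Phi>_meas[measurable]: "\<Phi> k \<in> borel_measurable noise_space" for k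
    unfolding \<Phi>_def by (intro borel_measurable_prod_ennreal) (auto split: prod.split intro!: measurable_compose[of "\<lambda>x. x s" for s, rotated])
  have \<Phi>_int: "(\<integral>\<^sup>+x. \<Phi> k x \<partial>Q \<omega>) = vec_power f k" for k
  proof -
    have "(\<integral>\<^sup>+x. \<Phi> k x \<partial>Q \<omega>) = (\<Prod>(i, m)\<in>(SIGMA i:UNIV. {..<k $ i}). \<integral>\<^sup>+x. vec_power s (x (Offspring n m i)) \<partial>Q \<omega>)"
      unfolding \<Phi>_def case_prod_beta
      by (rule nn_integral_prod_indep[OF \<omega>, where K = "\<lambda>(i, m). {Offspring n m i}"])
        (auto simp: disjoint_family_on_def depends_on_def)
    also have "\<dots> = (\<Prod>(i, m)\<in>(SIGMA i:UNIV. {..<k $ i}). f i)"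
      by (simp add: nn_integral_coordinate[OF \<omega>, where f = "vec_power s"] f_def)
    also have "\<dots> = vec_power f k"
      by (subst prod.Sigma[symmetric]) (auto simp: vec_power_def)
    finally show ?thesis .
  qed
  have "(\<integral>\<^sup>+x. vec_power s (branching z x (Suc n)) \<partial>Q \<omega>) = vec_power F z * (G * g)" for z
  proof -
    let ?W = "\<lambda>x. branching z x n + x (Immigrants n)"
    have W_meas: "?W \<in> noise_space \<rightarrow>\<^sub>M count_space UNIV"
      by (rule measurable_compose_countable[where f = "\<lambda>k x. k + x (Immigrants n)" and g = "\<lambda>x. branching z x n"])
        (auto intro!: measurable_compose[of "\<lambda>x. x s" for s, rotated])
    have "(\<integral>\<^sup>+x. vec_power s (branching z x (Suc n)) \<partial>Q \<omega>) = (\<integral>\<^sup>+x. \<Phi> (?W x) x \<partial>Q \<omega>)"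
      by (simp add: vec_power_sum \<Phi>_def prod.Sigma)
    also have "\<dots> = (\<integral>\<^sup>+x. (\<integral>\<^sup>+y. \<Phi> (?W x) y \<partial>Q \<omega>) \<partial>Q \<omega>)"
    proof (rule nn_integral_freeze[OF \<omega>, where A = "{s. source_time s < n} \<union> {Immigrants n}" and B = "{Offspring n m i |m i. True}"])
      show "depends_on ?W ({s. source_time s < n} \<union> {Immigrants n})"
        by (intro depends_on_compose2[where h = "(+)"] depends_on_mono[OF branching_depends_on] depends_on_coordinate) auto
      show "depends_on (\<Phi> k) {Offspring n m i |m i. True}" for k
        unfolding depends_on_def \<Phi>_def by (auto intro!: prod.cong)
    qed (auto intro: W_meas)
    also have "\<dots> = (\<integral>\<^sup>+x. vec_power f (branching z x n) * vec_power f (x (Immigrants n)) \<partial>Q \<omega>)"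
      unfolding \<Phi>_int vec_power_add ..
    also have "\<dots> = (\<integral>\<^sup>+x. vec_power f (branching z x n) \<partial>Q \<omega>) * g"
      unfolding g_def
      by (rule nn_integral_mult_indep[OF \<omega>, where A = "{s. source_time s < n}" and B = "{Immigrants n}"])
        (auto intro!: depends_on_compose[where h = "vec_power f"] branching_depends_on depends_on_coordinate measurable_compose[OF branching_measurable])
    finally show ?thesis by (simp add: FG mult.assoc)
  qed
  then show ?case by blast
qed

text \<open>At \<open>s = 0\<close> the generating function is the extinction probability. The start
  \<open>1\<close> has exponent one in every type, so positivity there makes \<open>G\<close> and
  each \<open>F i\<close> nonzero, and with them the monomial of any start.\<close>

lemma extinction_pos_all_starts:
  assumes "quenched_extinction q p \<omega> m > 0"
  shows "emeasure (Q \<omega>) {x. branching z x m = 0} \<noteq> 0"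
proof -
  obtain F G where FG: "\<And>z. (\<integral>\<^sup>+x. vec_power (\<lambda>_. 0) (branching z x m) \<partial>Q \<omega>) = vec_power F z * G"
    using generating_function by metis
  have e: "emeasure (Q \<omega>) {x. branching z x m = 0} = vec_power F z * G" for z
  proof -
    have [measurable]: "{x. branching z x m = 0} \<in> sets noise_space"
      using measurable_sets[OF branching_measurable[of z m], of "{0}"] by (simp add: vimage_def)
    have "(\<integral>\<^sup>+x. vec_power (\<lambda>_. 0) (branching z x m) \<partial>Q \<omega>) = (\<integral>\<^sup>+x. indicator {x. branching z x m = 0} x \<partial>Q \<omega>)"
      by (rule nn_integral_cong) (simp add: vec_power_0)
    also have "\<dots> = emeasure (Q \<omega>) {x. branching z x m = 0}"
      by (rule nn_integral_indicator) (simp add: sets_quenched[OF \<omega>])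
    finally show ?thesis using FG by simp
  qed
  have "emeasure (Q \<omega>) {x. branching 1 x m = 0} \<noteq> 0"
    using assms by (auto simp: quenched_extinction_def measure_def)
  then have "vec_power F 1 \<noteq> 0" "G \<noteq> 0" unfolding e by auto
  then have "F i \<noteq> 0" for i by (auto simp: vec_power_def)
  then show ?thesis using \<open>G \<noteq> 0\<close> unfolding e by (auto simp: vec_power_def)
qed

text \<open>Wald's identity for the random sums, through \<open>nn_integral_freeze\<close>. In
  \<open>ennreal\<close> it also holds when means are infinite.\<close>

lemma nn_mean_step:
  "(\<integral>\<^sup>+x. of_nat (branching z x (Suc n) $ j) \<partial>Q \<omega>) =
   (\<Sum>i\<in>UNIV. ((\<integral>\<^sup>+x. of_nat (branching z x n $ i) \<partial>Q \<omega>) + coord_mean \<omega> (Immigrants n) i) * coord_mean \<omega> (Offspring n 0 i) j)"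
proof -
  let ?W = "\<lambda>x. branching z x n + x (Immigrants n)"
  define \<Phi> :: "nat ^ 'd \<Rightarrow> 'd noise \<Rightarrow> ennreal"
    where "\<Phi> k x = (\<Sum>i\<in>UNIV. \<Sum>m<k $ i. of_nat (x (Offspring n m i) $ j))" for k x
  have coord_meas[measurable]: "(\<lambda>x. of_nat (x s $ i)) \<in> borel_measurable noise_space" for s :: "'d source" and i
    by (rule measurable_compose[of "\<lambda>x. x s" _ "count_space UNIV"]) auto
  have Z_meas[measurable]: "(\<lambda>x. of_nat (branching z x n $ i)) \<in> borel_measurable noise_space" for i
    by (rule measurable_compose[OF branching_measurable]) auto
  have W_meas: "?W \<in> noise_space \<rightarrow>\<^sub>M count_space UNIV"
    by (rule measurable_compose_countable[where f = "\<lambda>k x. k + x (Immigrants n)" and g = "\<lambda>x. branching z x n"])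
      (auto intro!: measurable_compose[of "\<lambda>x. x s" for s, rotated])
  have \<Phi>_int: "(\<integral>\<^sup>+x. \<Phi> k x \<partial>Q \<omega>) = (\<Sum>i\<in>UNIV. of_nat (k $ i) * coord_mean \<omega> (Offspring n 0 i) j)" for k
    unfolding \<Phi>_def by (simp add: nn_integral_sum nn_integral_coordinate[OF \<omega>, where f = "\<lambda>y. of_nat (y $ j)"])
  have "(\<integral>\<^sup>+x. of_nat (branching z x (Suc n) $ j) \<partial>Q \<omega>) = (\<integral>\<^sup>+x. \<Phi> (?W x) x \<partial>Q \<omega>)"
    by (simp add: \<Phi>_def)
  also have "\<dots> = (\<integral>\<^sup>+x. (\<integral>\<^sup>+y. \<Phi> (?W x) y \<partial>Q \<omega>) \<partial>Q \<omega>)"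
  proof (rule nn_integral_freeze[OF \<omega>, where A = "{s. source_time s < n} \<union> {Immigrants n}" and B = "{Offspring n m i |m i. True}"])
    show "depends_on ?W ({s. source_time s < n} \<union> {Immigrants n})"
      by (intro depends_on_compose2[where h = "(+)"] depends_on_mono[OF branching_depends_on] depends_on_coordinate) auto
    show "depends_on (\<Phi> k) {Offspring n m i |m i. True}" for k
      unfolding depends_on_def \<Phi>_def by (auto intro!: sum.cong)
    show "\<Phi> k \<in> borel_measurable noise_space" for k unfolding \<Phi>_def by measurable
  qed (auto intro: W_meas)
  also have "\<dots> = (\<integral>\<^sup>+x. (\<Sum>i\<in>UNIV. (of_nat (branching z x n $ i) + of_nat (x (Immigrants n) $ i)) * coord_mean \<omega> (Offspring n 0 i) j) \<partial>Q \<omega>)"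
    unfolding \<Phi>_int by simp
  also have "\<dots> = (\<Sum>i\<in>UNIV. ((\<integral>\<^sup>+x. of_nat (branching z x n $ i) \<partial>Q \<omega>) + (\<integral>\<^sup>+x. of_nat (x (Immigrants n) $ i) \<partial>Q \<omega>)) * coord_mean \<omega> (Offspring n 0 i) j)"
    by (subst nn_integral_sum, simp, intro sum.cong refl, subst nn_integral_multc, simp, subst nn_integral_add) auto
  finally show ?thesis by (simp add: nn_integral_coordinate[OF \<omega>, where f = "\<lambda>y. of_nat (y $ i)" for i])
qed

lemma integrable_coordinate_iff:
  "integrable (Q \<omega>) (\<lambda>x. real (x s $ j)) \<longleftrightarrow> coord_mean \<omega> s j < \<infinity>"
  and integral_coordinate: "(\<integral>x. real (x s $ j) \<partial>Q \<omega>) = enn2real (coord_mean \<omega> s j)"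
proof -
  have meas: "(\<lambda>x. real (x s $ j)) \<in> borel_measurable (Q \<omega>)"
    using measurable_compose[of "\<lambda>x. x s" noise_space "count_space UNIV" "\<lambda>k. real (k $ j)" borel] by simp
  have nn: "(\<integral>\<^sup>+x. ennreal (real (x s $ j)) \<partial>Q \<omega>) = coord_mean \<omega> s j"
    using nn_integral_coordinate[OF \<omega>, of "\<lambda>y. of_nat (y $ j)" s] by (simp add: ennreal_of_nat_eq_real_of_nat)
  show "integrable (Q \<omega>) (\<lambda>x. real (x s $ j)) \<longleftrightarrow> coord_mean \<omega> s j < \<infinity>"
    unfolding integrable_iff_bounded using meas nn by simp
  show "(\<integral>x. real (x s $ j) \<partial>Q \<omega>) = enn2real (coord_mean \<omega> s j)"
    using integral_eq_nn_integral[OF meas] nn by simp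
qed

lemma imm_mean_nth: "imm_mean q p \<omega> n $ i = enn2real (coord_mean \<omega> (Immigrants n) i)"
  by (simp add: imm_mean_def integral_coordinate)

lemma offspring_mean_nth: "offspring_mean q p \<omega> n $ j $ i = enn2real (coord_mean \<omega> (Offspring n 0 i) j)"
  by (simp add: offspring_mean_def integral_coordinate)

lemma finite_imm_mean_iff: "finite_imm_mean q p \<omega> n \<longleftrightarrow> (\<forall>i. coord_mean \<omega> (Immigrants n) i < \<infinity>)"
  by (simp add: finite_imm_mean_def integrable_coordinate_iff)

lemma finite_offspring_mean_iff:
  "finite_offspring_mean q p \<omega> n \<longleftrightarrow> (\<forall>i j. coord_mean \<omega> (Offspring n 0 i) j < \<infinity>)"
  by (simp add: finite_offspring_mean_def integrable_coordinate_iff)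

end

lemma imm_mean_shift:
  assumes "\<omega> \<in> space P"
  shows "imm_mean q p ((env_shift ^^ n) \<omega>) k = imm_mean q p \<omega> (n + k)"
  using source_law_later_funpow[of \<omega> n "Immigrants k"]
  by (simp add: vec_eq_iff imm_mean_nth assms env_shift_space)

lemma offspring_mean_shift:
  assumes "\<omega> \<in> space P"
  shows "offspring_mean q p ((env_shift ^^ n) \<omega>) k = offspring_mean q p \<omega> (n + k)"
  using source_law_later_funpow[of \<omega> n "Offspring k 0 i" for i]
  by (simp add: vec_eq_iff offspring_mean_nth assms env_shift_space)

lemma mean_product_add:
  assumes "\<omega> \<in> space P"
  shows "mean_product q p \<omega> (n + k) = mean_product q p ((env_shift ^^ n) \<omega>) k ** mean_product q p \<omega> n"
  by (induction k) (auto simp: offspring_mean_shift[OF assms] matrix_mul_assoc)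

text \<open>The candidate for the quenched mean of the process started at 0. Built from Bochner
  means, it is real valued for every environment; \<open>nn_mean_eq_population_mean\<close>
  identifies it with the mean under \<open>finite_means\<close>.\<close>

primrec population_mean :: "(int \<Rightarrow> 'a) \<Rightarrow> nat \<Rightarrow> real ^ 'd" where
  "population_mean \<omega> 0 = 0"
| "population_mean \<omega> (Suc n) = offspring_mean q p \<omega> n *v (population_mean \<omega> n + imm_mean q p \<omega> n)"

text \<open>Summand \<open>k\<close> is the mean number of descendants, at time \<open>n\<close>, of
  the immigrants that arrive at time \<open>k\<close>.\<close>

lemma population_mean_eq_sum:
  assumes \<omega>: "\<omega> \<in> space P"
  shows "population_mean \<omega> n =
    (\<Sum>k<n. mean_product q p ((env_shift ^^ k) \<omega>) (n - k) *v imm_mean q p \<omega> k)"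
proof (induction n)
  case (Suc n)
  have "offspring_mean q p \<omega> n ** mean_product q p ((env_shift ^^ k) \<omega>) (n - k)
      = mean_product q p ((env_shift ^^ k) \<omega>) (Suc n - k)" if "k < n" for k
    using that offspring_mean_shift[OF \<omega>, of k "n - k"] by (simp add: Suc_diff_le)
  moreover have "mean_product q p ((env_shift ^^ n) \<omega>) (Suc n - n) = offspring_mean q p \<omega> n"
    using offspring_mean_shift[OF \<omega>, of n 0] by (simp add: Suc_diff_le)
  ultimately show ?case
    by (simp add: Suc matrix_vector_right_distrib matrix_vector_mul_assoc linear_sum[OF matrix_vector_mul_linear])
qed simp

definition finite_means :: "(int \<Rightarrow> 'a) \<Rightarrow> bool" where
  "finite_means \<omega> \<longleftrightarrow> (\<forall>n. finite_imm_mean q p \<omega> n \<and> finite_offspring_mean q p \<omega> n)"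

lemma AE_finite_means:
  assumes "AE \<omega> in P. finite_imm_mean q p \<omega> 0" "AE \<omega> in P. finite_offspring_mean q p \<omega> 0"
  shows "AE \<omega> in P. finite_means \<omega>"
proof -
  have "AE \<omega> in P. finite_imm_mean q p \<omega> n \<and> finite_offspring_mean q p \<omega> n" for n
    using E.AE_funpow[OF assms(1), of n] E.AE_funpow[OF assms(2), of n] AE_space
  proof eventually_elim
    case (elim \<omega>)
    show ?case
      using elim(1,2) source_law_later_funpow[of \<omega> n "Immigrants 0"] source_law_later_funpow[of \<omega> n "Offspring 0 0 i" for i]
      by (simp add: finite_imm_mean_iff finite_offspring_mean_iff elim(3) env_shift_space)
  qed
  then show ?thesis unfolding finite_means_def by (subst AE_all_countable) simp
qed

lemma nn_mean_eq_population_mean: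
  assumes \<omega>: "\<omega> \<in> space P" and fin: "finite_means \<omega>"
  shows "(\<integral>\<^sup>+x. of_nat (branching 0 x n $ j) \<partial>Q \<omega>) = ennreal (population_mean \<omega> n $ j) \<and>
    0 \<le> population_mean \<omega> n $ j"
proof (induction n arbitrary: j)
  case (Suc n)
  have imm: "coord_mean \<omega> (Immigrants n) i = ennreal (imm_mean q p \<omega> n $ i)" "0 \<le> imm_mean q p \<omega> n $ i" for i
    using fin by (auto simp: finite_means_def finite_imm_mean_iff imm_mean_nth \<omega> ennreal_enn2real)
  have off: "coord_mean \<omega> (Offspring n 0 i) j = ennreal (offspring_mean q p \<omega> n $ j $ i)" "0 \<le> offspring_mean q p \<omega> n $ j $ i" for i
    using fin by (auto simp: finite_means_def finite_offspring_mean_iff offspring_mean_nth \<omega> ennreal_enn2real)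
  show ?case
    using Suc imm off unfolding nn_mean_step[OF \<omega>]
    by (auto simp: matrix_vector_mult_def ennreal_plus[symmetric] ennreal_mult'[symmetric] sum_ennreal
      mult.commute simp del: ennreal_plus intro!: sum_nonneg)
qed (simp)

text \<open>Markov's inequality for the total population; a count above \<open>K\<close> is at least
  \<open>Suc K\<close>.\<close>

lemma quenched_population_tail:
  assumes \<omega>: "\<omega> \<in> space P" and fin: "finite_means \<omega>"
  shows "emeasure (Q \<omega>) {x. \<exists>j. K < branching 0 x n $ j} \<le> ennreal (norm1 (population_mean \<omega> n) / real (Suc K))"
proof -
  let ?B = "{x. \<exists>j. K < branching 0 x n $ j}"
  have [measurable]: "(\<lambda>x. of_nat (branching 0 x n $ i)) \<in> borel_measurable noise_space" for i
    by (rule measurable_compose[OF branching_measurable]) auto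
  have B: "?B \<in> sets (Q \<omega>)"
    using measurable_sets[OF branching_measurable[of 0 n], of "{k. \<exists>j. K < k $ j}"] sets_quenched[OF \<omega>] by (simp add: vimage_def)
  have nn: "\<And>j. 0 \<le> population_mean \<omega> n $ j" using nn_mean_eq_population_mean[OF assms] by blast
  have "of_nat (Suc K) * emeasure (Q \<omega>) ?B = (\<integral>\<^sup>+x. of_nat (Suc K) * indicator ?B x \<partial>Q \<omega>)"
    by (rule nn_integral_cmult_indicator[symmetric]) (rule B)
  also have "\<dots> \<le> (\<integral>\<^sup>+x. (\<Sum>j\<in>UNIV. of_nat (branching 0 x n $ j)) \<partial>Q \<omega>)"
  proof (rule nn_integral_mono)
    fix x
    show "of_nat (Suc K) * indicator ?B x \<le> (\<Sum>j\<in>UNIV. of_nat (branching 0 x n $ j) :: ennreal)"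
    proof (cases "x \<in> ?B")
      case True
      then obtain j where "Suc K \<le> branching 0 x n $ j" by (auto simp: Suc_le_eq)
      then have "of_nat (Suc K) \<le> (of_nat (branching 0 x n $ j) :: ennreal)" by (rule of_nat_mono)
      also have "\<dots> \<le> (\<Sum>j\<in>UNIV. of_nat (branching 0 x n $ j))" by (rule member_le_sum) auto
      finally show ?thesis using True by simp
    qed simp
  qed
  also have "\<dots> = (\<Sum>j\<in>UNIV. ennreal (population_mean \<omega> n $ j))"
    using nn_mean_eq_population_mean[OF assms] by (subst nn_integral_sum) (auto simp: \<omega>)
  also have "\<dots> = ennreal (norm1 (population_mean \<omega> n))"
    using nn by (simp add: norm1_def sum_ennreal)
  finally have *: "of_nat (Suc K) * emeasure (Q \<omega>) ?B \<le> ennreal (norm1 (population_mean \<omega> n))" .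
  interpret prob_space "Q \<omega>" by (rule prob_space_quenched[OF \<omega>])
  from * have "ennreal (real (Suc K) * prob ?B) \<le> ennreal (norm1 (population_mean \<omega> n))"
    unfolding emeasure_eq_measure ennreal_of_nat_eq_real_of_nat by (simp add: ennreal_mult' del: of_nat_Suc)
  then have "real (Suc K) * prob ?B \<le> norm1 (population_mean \<omega> n)"
    by (subst (asm) ennreal_le_iff) (auto simp: norm1_def intro: sum_nonneg)
  then show ?thesis unfolding emeasure_eq_measure
    by (intro ennreal_leI) (simp add: field_simps)
qed

end

section \<open>Tightness of the quenched means\<close>

lemma norm1_nonneg: "0 \<le> norm1 v"
  by (simp add: norm1_def sum_nonneg)

lemma norm1_triangle_sum: "norm1 (\<Sum>k\<in>K. f k) \<le> (\<Sum>k\<in>K. norm1 (f k))"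
proof -
  have "norm1 (\<Sum>k\<in>K. f k) \<le> (\<Sum>i\<in>UNIV. \<Sum>k\<in>K. \<bar>f k $ i\<bar>)"
    unfolding norm1_def by (intro sum_mono) (simp add: sum_abs)
  also have "\<dots> = (\<Sum>k\<in>K. norm1 (f k))" unfolding norm1_def by (rule sum.swap)
  finally show ?thesis .
qed

lemma norm1_matrix_vector_le_columns:
  "norm1 (A *v v) \<le> (MAX i. norm1 (column i A)) * norm1 v"
proof -
  have "norm1 (A *v v) \<le> (\<Sum>j\<in>UNIV. \<Sum>i\<in>UNIV. \<bar>A $ j $ i\<bar> * \<bar>v $ i\<bar>)"
    unfolding norm1_def by (intro sum_mono) (simp add: matrix_vector_mult_def order_trans[OF sum_abs] abs_mult)
  also have "\<dots> = (\<Sum>i\<in>UNIV. norm1 (column i A) * \<bar>v $ i\<bar>)"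
    by (subst sum.swap) (simp add: norm1_def column_def sum_distrib_right)
  also have "\<dots> \<le> (\<Sum>i\<in>UNIV. (MAX i. norm1 (column i A)) * \<bar>v $ i\<bar>)"
    by (intro sum_mono mult_right_mono Max_ge) auto
  finally show ?thesis by (simp add: norm1_def sum_distrib_left)
qed

text \<open>The supremum is attained at a coordinate vector. Written as a finite maximum of column
  sums, the operator norm is visibly measurable in the matrix entries.\<close>

lemma opnorm1_eq_Max: "opnorm1 A = (MAX i. norm1 (column i A))"
  unfolding opnorm1_def
proof (rule cSup_eq_maximum)
  have "(MAX i. norm1 (column i A)) \<in> range (\<lambda>i. norm1 (column i A))" by (rule Max_in) auto
  then obtain i where "(MAX i. norm1 (column i A)) = norm1 (column i A)" by blast
  moreover have "norm1 (axis i (1::real)) = 1"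
    by (simp add: norm1_def axis_def if_distrib cong: if_cong)
  ultimately show "(MAX i. norm1 (column i A)) \<in> (\<lambda>v. norm1 (A *v v)) ` {v. norm1 v \<le> 1}"
    by (intro image_eqI[of _ _ "axis i 1"]) (auto simp: matrix_vector_mult_basis)
next
  fix x assume "x \<in> (\<lambda>v. norm1 (A *v v)) ` {v. norm1 v \<le> 1}"
  then obtain v where v: "x = norm1 (A *v v)" "norm1 v \<le> 1" by auto
  have "0 \<le> (MAX i. norm1 (column i A))"
    by (subst Max_ge_iff) (auto simp: norm1_nonneg)
  then show "x \<le> (MAX i. norm1 (column i A))"
    using norm1_matrix_vector_le_columns[of A v] v mult_left_le by (metis order_trans)
qed

lemma norm1_matrix_vector_le: "norm1 (A *v v) \<le> opnorm1 A * norm1 v"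
  unfolding opnorm1_eq_Max by (rule norm1_matrix_vector_le_columns)

lemma opnorm1_nonneg: "0 \<le> opnorm1 A"
  unfolding opnorm1_eq_Max by (subst Max_ge_iff) (auto simp: norm1_nonneg)

lemma norm1_column_le: "norm1 (column i A) \<le> opnorm1 A"
  unfolding opnorm1_eq_Max by (rule Max_ge) auto

lemma opnorm1_mult_le: "opnorm1 (A ** B) \<le> opnorm1 A * opnorm1 B"
proof -
  have "norm1 (column i (A ** B)) \<le> opnorm1 A * opnorm1 B" for i
  proof -
    have "column i (A ** B) = A *v column i B"
      by (simp add: vec_eq_iff column_def matrix_matrix_mult_def matrix_vector_mult_def)
    then have "norm1 (column i (A ** B)) \<le> opnorm1 A * norm1 (column i B)"
      by (simp add: norm1_matrix_vector_le)
    also have "\<dots> \<le> opnorm1 A * opnorm1 B"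
      by (intro mult_left_mono norm1_column_le opnorm1_nonneg)
    finally show ?thesis .
  qed
  then show ?thesis unfolding opnorm1_eq_Max[of "A ** B"] by (subst Max_le_iff) auto
qed

lemma measurable_norm1:
  assumes "\<And>i. (\<lambda>x. f x $ i) \<in> borel_measurable M"
  shows "(\<lambda>x. norm1 (f x)) \<in> borel_measurable M"
  unfolding norm1_def using assms by measurable

lemma measurable_opnorm1:
  assumes "\<And>i j. (\<lambda>x. f x $ i $ j) \<in> borel_measurable M"
  shows "(\<lambda>x. opnorm1 (f x)) \<in> borel_measurable M"
  unfolding opnorm1_eq_Max
  by (intro borel_measurable_Max measurable_norm1) (auto simp: column_def assms)

section \<open>Extended logarithms and their expectations\<close>

lemma e2ennreal_elog: "0 \<le> x \<Longrightarrow> e2ennreal (elog x) = ennreal (ln (max 1 x))"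
  by (auto simp: elog_def max_def ennreal_neg e2ennreal_neg)

lemma e2ennreal_max_0: "e2ennreal (max 0 y) = e2ennreal y"
  by (cases "0 \<le> y") (auto simp: max_def e2ennreal_neg)

lemma integrable_log_plus:
  fixes f :: "'a \<Rightarrow> real"
  assumes [measurable]: "f \<in> borel_measurable M" and nn: "\<And>x. 0 \<le> f x"
    and fin: "eexpectation M (\<lambda>x. max 0 (elog (f x))) < \<infinity>"
  shows "integrable M (\<lambda>x. ln (max 1 (f x)))"
proof (rule integrableI_nonneg)
  have neg: "e2ennreal (- max 0 (elog (f x))) = 0" for x
    by (rule e2ennreal_neg) (simp add: max_def)
  have "enn2ereal (\<integral>\<^sup>+x. ennreal (ln (max 1 (f x))) \<partial>M) < \<infinity>"
    using fin unfolding eexpectation_def neg e2ennreal_max_0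
    by (simp add: e2ennreal_elog nn zero_ennreal.rep_eq)
  then show "(\<integral>\<^sup>+x. ennreal (ln (max 1 (f x))) \<partial>M) < \<infinity>"
    by (simp add: less_ennreal.rep_eq infinity_ennreal_def top_ennreal.rep_eq)
qed auto

text \<open>The expectation of the logarithm may be -infinity. Truncating \<open>f\<close> from
  below at \<open>exp (- real k)\<close> gives a real integral, and by monotone convergence of the
  negative parts some \<open>k\<close> already outweighs the positive part.\<close>

lemma truncated_log_integral_neg:
  fixes f :: "'a \<Rightarrow> real"
  assumes [measurable]: "f \<in> borel_measurable M" and nn: "\<And>x. 0 \<le> f x"
    and neg: "eexpectation M (\<lambda>x. elog (f x)) < 0"
    and finM: "finite_measure M"
  shows "\<exists>k::nat. integrable M (\<lambda>x. ln (max (exp (- real k)) (f x))) \<and>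
    (\<integral>x. ln (max (exp (- real k)) (f x)) \<partial>M) < 0"
proof -
  interpret finite_measure M by fact
  define \<psi> where "\<psi> x = e2ennreal (- elog (f x))" for x
  define v where "v k x = max 0 (- ln (max (exp (- real k)) (f x)))" for k :: nat and x
  have [measurable]: "v k \<in> borel_measurable M" for k unfolding v_def by measurable
  have v_le: "v k x \<le> real k" for k x
  proof -
    have "ln (exp (- real k)) \<le> ln (max (exp (- real k)) (f x))" by (subst ln_le_cancel_iff) (auto simp: less_max_iff_disj)
    then show ?thesis by (simp add: v_def)
  qed
  have \<psi>_sup: "(SUP k. ennreal (v k x)) = \<psi> x" for x
  proof (cases "f x = 0")
    case True
    then have "ennreal (v k x) = of_nat k" for k by (simp add: v_def max_def ennreal_of_nat_eq_real_of_nat)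
    moreover have "\<psi> x = top" using True by (simp add: \<psi>_def elog_def)
    ultimately show ?thesis by (simp add: ennreal_SUP_of_nat_eq_top)
  next
    case False
    then have pos: "0 < f x" using nn[of x] by simp
    have \<psi>: "\<psi> x = ennreal (max 0 (- ln (f x)))"
      using False by (auto simp: \<psi>_def elog_def max_def ennreal_neg)
    obtain k0 :: nat where k0: "- ln (f x) \<le> real k0" using real_arch_simple by blast
    have "exp (- real k0) \<le> exp (ln (f x))" using k0 by (subst exp_le_cancel_iff) simp
    then have "v k0 x = max 0 (- ln (f x))" using pos by (simp add: v_def max_def)
    moreover have "v k x \<le> max 0 (- ln (f x))" for k
    proof -
      have "ln (f x) \<le> ln (max (exp (- real k)) (f x))"
        using pos by (subst ln_le_cancel_iff) (auto simp: less_max_iff_disj)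
      then show ?thesis by (auto simp: v_def)
    qed
    ultimately show ?thesis unfolding \<psi>
      by (intro antisym SUP_least ennreal_leI) (auto intro: SUP_upper2[of k0])
  qed
  have v_mono: "v k x \<le> v (Suc k) x" for k x
  proof -
    have "exp (- real (Suc k)) \<le> exp (- real k)" by simp
    then have "max (exp (- real (Suc k))) (f x) \<le> max (exp (- real k)) (f x)"
      by (intro max.mono) auto
    then have "ln (max (exp (- real (Suc k))) (f x)) \<le> ln (max (exp (- real k)) (f x))"
      by (subst ln_le_cancel_iff) (auto simp: less_max_iff_disj)
    then show ?thesis by (auto simp: v_def)
  qed
  have "(\<integral>\<^sup>+x. \<psi> x \<partial>M) = (\<integral>\<^sup>+x. (SUP k. ennreal (v k x)) \<partial>M)" by (simp add: \<psi>_sup)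
  also have "\<dots> = (SUP k. \<integral>\<^sup>+x. ennreal (v k x) \<partial>M)"
    by (rule nn_integral_monotone_convergence_SUP) (auto simp: incseq_Suc_iff le_fun_def intro!: ennreal_leI v_mono)
  finally have SUP: "(\<integral>\<^sup>+x. \<psi> x \<partial>M) = (SUP k. \<integral>\<^sup>+x. ennreal (v k x) \<partial>M)" .
  let ?p = "\<integral>\<^sup>+x. ennreal (ln (max 1 (f x))) \<partial>M"
  have "enn2ereal ?p - enn2ereal (\<integral>\<^sup>+x. \<psi> x \<partial>M) < 0"
    using neg unfolding eexpectation_def \<psi>_def by (simp add: e2ennreal_elog nn)
  \<comment> \<open>A negative difference excludes \<open>?p = \<infinity>\<close>, because on
    \<open>ereal\<close> both \<open>\<infinity> - y\<close> for finite \<open>y\<close> and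
    \<open>\<infinity> - \<infinity>\<close> are \<open>\<infinity>\<close>.\<close>
  then have "?p < (\<integral>\<^sup>+x. \<psi> x \<partial>M)"
    by (cases ?p; cases "\<integral>\<^sup>+x. \<psi> x \<partial>M") (auto simp: top_ennreal.rep_eq enn2ereal_ennreal ennreal_less_iff)
  then obtain k where k: "?p < (\<integral>\<^sup>+x. ennreal (v k x) \<partial>M)" unfolding SUP less_SUP_iff by auto
  have int_p: "integrable M (\<lambda>x. ln (max 1 (f x)))"
  proof (rule integrableI_nonneg)
    show "?p < \<infinity>" using k by (simp add: order_less_le_trans[OF _ top_greatest])
  qed auto
  have int_v: "integrable M (v k)"
    by (rule integrable_const_bound[of _ "real k"]) (use v_le in \<open>auto simp: v_def\<close>)
  have split: "ln (max (exp (- real k)) (f x)) = ln (max 1 (f x)) - v k x" for x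
  proof (cases "1 \<le> f x")
    case True
    moreover have "exp (- real k) \<le> 1" by simp
    ultimately have "max (exp (- real k)) (f x) = f x" by linarith
    then show ?thesis using True by (simp add: v_def)
  next
    case False
    then have "ln (max (exp (- real k)) (f x)) \<le> ln 1" by (subst ln_le_cancel_iff) (auto simp: less_max_iff_disj)
    then show ?thesis using False by (simp add: v_def max_def)
  qed
  have "ennreal (\<integral>x. ln (max 1 (f x)) \<partial>M) = ?p"
    by (rule nn_integral_eq_integral[symmetric, OF int_p]) auto
  moreover have "ennreal (\<integral>x. v k x \<partial>M) = (\<integral>\<^sup>+x. ennreal (v k x) \<partial>M)"
    by (rule nn_integral_eq_integral[symmetric, OF int_v]) (auto simp: v_def)
  ultimately have "(\<integral>x. ln (max 1 (f x)) \<partial>M) < (\<integral>x. v k x \<partial>M)"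
    using k by (metis ennreal_leI not_le)
  then show ?thesis
    using int_p int_v by (intro exI[of _ k]) (simp add: split)
qed

text \<open>The excess \<open>h\<close> of \<open>\<phi>\<close> over a large level \<open>K\<close>
  has mean below \<open>e\<close>, so the orbit sums of \<open>h - e\<close> are bounded above
  almost surely; a single term of \<open>h\<close>, being at most the whole sum, then grows at most
  like \<open>e * n\<close>.\<close>

lemma (in ergodic_system) integrable_AE_sublinear:
  fixes \<phi> :: "'a \<Rightarrow> real"
  assumes int: "integrable M \<phi>" and e: "0 < e"
  shows "AE x in M. \<exists>C. \<forall>n. \<phi> ((T ^^ n) x) \<le> C + e * real n"
proof -
  have [measurable]: "\<phi> \<in> borel_measurable M" using int by auto
  have "(\<lambda>k. \<integral>x. max 0 (\<phi> x - real k) \<partial>M) \<longlonglongrightarrow> (\<integral>x. 0 \<partial>M)"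
  proof (rule integral_dominated_convergence[where w = "\<lambda>x. \<bar>\<phi> x\<bar>"])
    show "AE x in M. (\<lambda>k. max 0 (\<phi> x - real k)) \<longlonglongrightarrow> 0"
    proof (rule AE_I2)
      fix x
      obtain k0 :: nat where "\<phi> x \<le> real k0" using real_arch_simple by blast
      then have "max 0 (\<phi> x - real k) = 0" if "k \<ge> k0" for k using that by auto
      then show "(\<lambda>k. max 0 (\<phi> x - real k)) \<longlonglongrightarrow> 0"
        by (intro tendsto_eventually) (auto simp: eventually_sequentially)
    qed
  qed (use int in auto)
  then have "\<forall>\<^sub>F k in sequentially. (\<integral>x. max 0 (\<phi> x - real k) \<partial>M) < e"
    using e by (intro order_tendstoD(2)) auto
  then obtain K where K: "(\<integral>x. max 0 (\<phi> x - real K) \<partial>M) < e"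
    by (auto simp: eventually_sequentially)
  define h where "h x = max 0 (\<phi> x - real K)" for x
  define g where "g n x = (\<Sum>i<n. h ((T ^^ i) x) - e)" for n x
  have h_int: "integrable M h" unfolding h_def by (intro integrable_max) (use int in auto)
  have [measurable]: "h \<in> borel_measurable M" unfolding h_def by measurable
  have g_int: "integrable M (g n)" for n
    unfolding g_def
    by (rule Bochner_Integration.integrable_sum, rule Bochner_Integration.integrable_diff,
        rule integrable_funpow, rule h_int) simp
  have "AE x in M. bdd_above (range (\<lambda>n. g n x))"
  proof (rule subadditive_AE_bdd_above[where N = 1])
    show "g n \<in> borel_measurable M" for n unfolding g_def by measurable
    show "g (n + k) x \<le> g n x + g k ((T ^^ n) x)" for n k x
    proof -
      have "(T ^^ (n + k)) x = (T ^^ k) ((T ^^ n) x)" for k by (simp add: add.commute[of n k] funpow_add)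
      then show ?thesis unfolding g_def by (induction k) simp_all
    qed
    have "(\<integral>x. g 1 x \<partial>M) = (\<integral>x. h x \<partial>M) - e" using h_int by (simp add: g_def prob_space)
    then show "(\<integral>x. g 1 x \<partial>M) < 0" using K by (simp add: h_def)
  qed (use g_int in auto)
  then show ?thesis
  proof eventually_elim
    case (elim x)
    then obtain C where C: "\<And>n. g n x \<le> C" by (auto simp: bdd_above_def)
    have "\<phi> ((T ^^ n) x) \<le> (real K + C + e) + e * real n" for n
    proof -
      have "\<phi> ((T ^^ n) x) - real K \<le> h ((T ^^ n) x)" by (simp add: h_def)
      also have "\<dots> \<le> (\<Sum>i<Suc n. h ((T ^^ i) x))"
        by (rule member_le_sum) (auto simp: h_def)
      also have "\<dots> = g (Suc n) x + e * real (Suc n)" by (simp add: g_def sum_subtractf algebra_simps)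
      finally show ?thesis using C[of "Suc n"] by (simp add: algebra_simps)
    qed
    then show ?case by blast
  qed
qed

section \<open>The inverse shift: the environment seen from the present\<close>

definition env_unshift :: "(int \<Rightarrow> 'a) \<Rightarrow> int \<Rightarrow> 'a" where
  "env_unshift \<omega> = (\<lambda>n. \<omega> (n - 1))"

lemma env_unshift_shift [simp]: "env_unshift (env_shift \<omega>) = \<omega>" "env_shift (env_unshift \<omega>) = \<omega>"
  by (auto simp: env_unshift_def env_shift_def)

lemma env_shift_unshift_funpow: "k \<le> n \<Longrightarrow> (env_shift ^^ k) ((env_unshift ^^ n) \<omega>) = (env_unshift ^^ (n - k)) \<omega>"
proof (induction k)
  case (Suc k)
  then have "(env_unshift ^^ (n - k)) \<omega> = env_unshift ((env_unshift ^^ (n - Suc k)) \<omega>)"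
    by (metis Suc_diff_Suc Suc_le_lessD comp_apply funpow.simps(2))
  then show ?case using Suc by simp
qed simp

context branching_environment
begin

lemma env_unshift_measurable [measurable]: "env_unshift \<in> P \<rightarrow>\<^sub>M P"
proof -
  have "env_unshift \<in> (\<Pi>\<^sub>M n\<in>(UNIV::int set). S) \<rightarrow>\<^sub>M (\<Pi>\<^sub>M n\<in>(UNIV::int set). S)"
    unfolding env_unshift_def by (rule measurable_PiM_single') (auto simp: space_PiM PiE_iff)
  then show ?thesis by (simp add: measurable_cong_sets[OF sets_P sets_P])
qed

lemma env_unshift_ergodic: "ergodic_system P env_unshift"
proof -
  have "distr P P env_unshift = distr (distr P P env_shift) P env_unshift"
    by (simp add: E.T_preserving)
  also have "\<dots> = distr P P (\<lambda>\<omega>. \<omega>)" by (subst distr_distr) (auto simp: comp_def)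
  finally have "distr P P env_unshift = P" by (simp add: distr_id2)
  moreover have "E.prob A = 0 \<or> E.prob A = 1"
    if A: "A \<in> E.events" and inv: "env_unshift -` A \<inter> space P = A" for A
  proof (rule E.T_ergodic[OF A])
    show "env_shift -` A \<inter> space P = A"
    proof (intro set_eqI)
      fix \<omega>
      show "\<omega> \<in> env_shift -` A \<inter> space P \<longleftrightarrow> \<omega> \<in> A"
        using inv sets.sets_into_space[OF A] measurable_space[OF env_shift_measurable, of \<omega>]
        by (auto simp: set_eq_iff) (metis env_unshift_shift(1) Int_iff vimageI)+
    qed
  qed
  ultimately show ?thesis by unfold_locales auto
qed

sublocale U: ergodic_system P env_unshift by (rule env_unshift_ergodic)

lemma offspring_mean_measurable: "(\<lambda>\<omega>. offspring_mean q p \<omega> n $ j $ i) \<in> borel_measurable P"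
proof -
  have "(\<lambda>\<omega>. enn2real (coord_mean \<omega> (Offspring n 0 i) j)) \<in> borel_measurable P" by measurable
  then show ?thesis by (rule measurable_cong[THEN iffD1, rotated]) (simp only: offspring_mean_nth)
qed

lemma imm_mean_measurable: "(\<lambda>\<omega>. imm_mean q p \<omega> n $ i) \<in> borel_measurable P"
proof -
  have "(\<lambda>\<omega>. enn2real (coord_mean \<omega> (Immigrants n) i)) \<in> borel_measurable P" by measurable
  then show ?thesis by (rule measurable_cong[THEN iffD1, rotated]) (simp only: imm_mean_nth)
qed

lemma mean_product_measurable: "(\<lambda>\<omega>. mean_product q p \<omega> n $ j $ i) \<in> borel_measurable P"
proof (induction n arbitrary: j i)
  case (Suc n)
  then show ?case using offspring_mean_measurable by (simp add: matrix_matrix_mult_def)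
qed simp

lemma population_mean_measurable: "(\<lambda>\<omega>. population_mean \<omega> n $ i) \<in> borel_measurable P"
proof (induction n arbitrary: i)
  case (Suc n)
  then show ?case using offspring_mean_measurable imm_mean_measurable by (simp add: matrix_vector_mult_def)
qed simp

text \<open>The norm of M_(-1) ... M_(-n), where M_k is built from the coordinate
  \<open>\<omega> k\<close>: time 0 of \<open>(env_unshift ^^ n) \<omega>\<close> is time -n of
  \<open>\<omega>\<close>.\<close>

definition backward_norm :: "nat \<Rightarrow> (int \<Rightarrow> 'a) \<Rightarrow> real" where
  "backward_norm n \<omega> = opnorm1 (mean_product q p ((env_unshift ^^ n) \<omega>) n)"

lemma env_unshift_space: "\<omega> \<in> space P \<Longrightarrow> (env_unshift ^^ n) \<omega> \<in> space P"
  by (rule measurable_space[OF U.funpow_meas])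

lemma opnorm1_mean_product_measurable [measurable]: "(\<lambda>\<omega>. opnorm1 (mean_product q p \<omega> n)) \<in> borel_measurable P"
  by (rule measurable_opnorm1) (rule mean_product_measurable)

lemma norm1_imm_mean_measurable [measurable]: "(\<lambda>\<omega>. norm1 (imm_mean q p \<omega> n)) \<in> borel_measurable P"
  by (rule measurable_norm1) (rule imm_mean_measurable)

lemma norm1_population_mean_measurable [measurable]: "(\<lambda>\<omega>. norm1 (population_mean \<omega> n)) \<in> borel_measurable P"
  by (rule measurable_norm1) (rule population_mean_measurable)

lemma backward_norm_measurable [measurable]: "backward_norm n \<in> borel_measurable P"
  unfolding backward_norm_def by (rule measurable_compose[OF U.funpow_meas]) measurable

lemma backward_norm_nonneg: "0 \<le> backward_norm n \<omega>"
  by (simp add: backward_norm_def opnorm1_nonneg)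

text \<open>The further \<open>k\<close> factors come from the more distant past, which is why the
  cocycle runs along \<open>env_unshift\<close>.\<close>

lemma backward_norm_add:
  assumes "\<omega> \<in> space P"
  shows "backward_norm (n + k) \<omega> \<le> backward_norm n \<omega> * backward_norm k ((env_unshift ^^ n) \<omega>)"
proof -
  have "(env_shift ^^ k) ((env_unshift ^^ (n + k)) \<omega>) = (env_unshift ^^ n) \<omega>"
    by (simp add: env_shift_unshift_funpow)
  moreover have "(env_unshift ^^ (n + k)) \<omega> = (env_unshift ^^ k) ((env_unshift ^^ n) \<omega>)"
    by (simp add: funpow_add add.commute[of n k])
  ultimately show ?thesis
    unfolding backward_norm_def
    using mean_product_add[OF env_unshift_space[OF assms, of "n + k"], of k n] opnorm1_mult_le
    by (simp add: add.commute)
qed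

text \<open>The immigrants of time \<open>k\<close> have age \<open>j = n - k\<close>, and after
  pulling back by \<open>n\<close> their term is read off the past of \<open>\<omega>\<close>
  without reference to \<open>n\<close>. A larger \<open>n\<close> only appends terms on the
  right.\<close>

lemma population_mean_backward_le:
  assumes \<omega>: "\<omega> \<in> space P"
  shows "norm1 (population_mean ((env_unshift ^^ n) \<omega>) n)
    \<le> (\<Sum>j=1..n. backward_norm j \<omega> * norm1 (imm_mean q p ((env_unshift ^^ j) \<omega>) 0))"
proof -
  let ?\<eta> = "(env_unshift ^^ n) \<omega>"
  have \<eta>: "?\<eta> \<in> space P" by (rule env_unshift_space[OF \<omega>])
  have "norm1 (population_mean ?\<eta> n)
    \<le> (\<Sum>k<n. norm1 (mean_product q p ((env_shift ^^ k) ?\<eta>) (n - k) *v imm_mean q p ?\<eta> k))"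
    unfolding population_mean_eq_sum[OF \<eta>] by (rule norm1_triangle_sum)
  also have "\<dots> \<le> (\<Sum>k<n. backward_norm (n - k) \<omega> * norm1 (imm_mean q p ((env_unshift ^^ (n - k)) \<omega>) 0))"
  proof (rule sum_mono)
    fix k assume "k \<in> {..<n}"
    then have s: "(env_shift ^^ k) ?\<eta> = (env_unshift ^^ (n - k)) \<omega>" by (simp add: env_shift_unshift_funpow)
    have "imm_mean q p ?\<eta> k = imm_mean q p ((env_unshift ^^ (n - k)) \<omega>) 0"
      using imm_mean_shift[OF \<eta>, of k 0] s by simp
    then show "norm1 (mean_product q p ((env_shift ^^ k) ?\<eta>) (n - k) *v imm_mean q p ?\<eta> k)
      \<le> backward_norm (n - k) \<omega> * norm1 (imm_mean q p ((env_unshift ^^ (n - k)) \<omega>) 0)"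
      unfolding s backward_norm_def by (simp add: norm1_matrix_vector_le)
  qed
  also have "\<dots> = (\<Sum>j=1..n. backward_norm j \<omega> * norm1 (imm_mean q p ((env_unshift ^^ j) \<omega>) 0))"
    by (rule sum.reindex_bij_witness[of _ "\<lambda>j. n - j" "\<lambda>k. n - k"]) auto
  finally show ?thesis .
qed

end

section \<open>Backward decay and tightness under (A1)-(A3)\<close>

locale subcritical_environment = branching_environment S P q p
  for S :: "'a measure" and P :: "(int \<Rightarrow> 'a) measure"
    and q :: "'a \<Rightarrow> (nat ^ 'd::finite) measure" and p :: "'d \<Rightarrow> 'a \<Rightarrow> (nat ^ 'd) measure" +
  assumes fin_imm: "AE \<omega> in P. finite_imm_mean q p \<omega> 0"
    and log_imm: "eexpectation P (\<lambda>\<omega>. max 0 (elog (norm1 (imm_mean q p \<omega> 0)))) < \<infinity>"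
    and fin_off: "AE \<omega> in P. finite_offspring_mean q p \<omega> 0"
    and log_off: "eexpectation P (\<lambda>\<omega>. max 0 (elog (opnorm1 (offspring_mean q p \<omega> 0)))) < \<infinity>"
    and subcritical: "\<exists>L<0. (\<lambda>n. ereal (1 / real n) *
        eexpectation P (\<lambda>\<omega>. elog (opnorm1 (mean_product q p \<omega> n)))) \<longlonglongrightarrow> L"
begin

text \<open>For one factor this is (A2), moved by stationarity; submultiplicativity passes it on to
  longer products.\<close>

lemma backward_norm_log_plus_integrable: "integrable P (\<lambda>\<omega>. ln (max 1 (backward_norm n \<omega>)))"
proof (induction n)
  case 0
  then show ?case by (simp add: backward_norm_def)
next
  case (Suc n)
  have "integrable P (\<lambda>\<omega>. ln (max 1 (opnorm1 (mean_product q p \<omega> 1))))"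
    by (rule integrable_log_plus[OF opnorm1_mean_product_measurable]) (use log_off in \<open>auto simp: opnorm1_nonneg\<close>)
  from U.integrable_funpow[OF this, of "1"] have int1: "integrable P (\<lambda>\<omega>. ln (max 1 (backward_norm 1 \<omega>)))"
    by (simp add: backward_norm_def)
  show ?case
  proof (rule Bochner_Integration.integrable_bound)
    show "integrable P (\<lambda>\<omega>. ln (max 1 (backward_norm n \<omega>)) + ln (max 1 (backward_norm 1 ((env_unshift ^^ n) \<omega>))))"
      using Suc U.integrable_funpow[OF int1] by auto
    show "AE \<omega> in P. norm (ln (max 1 (backward_norm (Suc n) \<omega>)))
      \<le> norm (ln (max 1 (backward_norm n \<omega>)) + ln (max 1 (backward_norm 1 ((env_unshift ^^ n) \<omega>))))"
    proof (rule AE_I2)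
      fix \<omega> assume \<omega>: "\<omega> \<in> space P"
      let ?a = "max 1 (backward_norm n \<omega>)" and ?b = "max 1 (backward_norm 1 ((env_unshift ^^ n) \<omega>))"
      have "backward_norm (Suc n) \<omega> \<le> backward_norm n \<omega> * backward_norm 1 ((env_unshift ^^ n) \<omega>)"
        using backward_norm_add[OF \<omega>, of n 1] by simp
      also have "\<dots> \<le> ?a * ?b"
        by (intro mult_mono) (auto simp: backward_norm_nonneg max.coboundedI2)
      finally have "backward_norm (Suc n) \<omega> \<le> ?a * ?b" .
      moreover have "1 * 1 \<le> ?a * ?b" by (rule mult_mono) auto
      ultimately have "ln (max 1 (backward_norm (Suc n) \<omega>)) \<le> ln (?a * ?b)"
        by (subst ln_le_cancel_iff) (auto simp: zero_less_mult_iff less_max_iff_disj)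
      also have "\<dots> = ln ?a + ln ?b" by (rule ln_mult_pos) auto
      finally show "norm (ln (max 1 (backward_norm (Suc n) \<omega>))) \<le> norm (ln ?a + ln ?b)" by simp
    qed
  qed measurable
qed

text \<open>The upper half of the Furstenberg-Kesten theorem at some exponential rate, from
  \<open>subadditive_AE_bdd_above\<close> applied to truncated logarithms plus a linear
  term.\<close>

lemma backward_norm_decay: "\<exists>e>0. AE \<omega> in P. \<exists>C. \<forall>n. backward_norm n \<omega> \<le> C * exp (- e * real n)"
proof -
  obtain L where L: "L < 0" "(\<lambda>n. ereal (1 / real n) * eexpectation P (\<lambda>\<omega>. elog (opnorm1 (mean_product q p \<omega> n)))) \<longlonglongrightarrow> L"
    using subcritical by auto
  then have "\<forall>\<^sub>F n in sequentially. ereal (1 / real n) * eexpectation P (\<lambda>\<omega>. elog (opnorm1 (mean_product q p \<omega> n))) < 0"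
    by (intro order_tendstoD(2))
  then obtain N where N: "N \<ge> 1" "ereal (1 / real N) * eexpectation P (\<lambda>\<omega>. elog (opnorm1 (mean_product q p \<omega> N))) < 0"
    unfolding eventually_sequentially by (metis nat_le_linear)
  then have "eexpectation P (\<lambda>\<omega>. elog (opnorm1 (mean_product q p \<omega> N))) < 0"
    by (metis ereal_less_eq(5) ereal_mult_le_0_iff  not_le zero_le_divide_1_iff of_nat_0_le_iff ereal_0_le_mult)
  then obtain k :: nat where k: "integrable P (\<lambda>\<omega>. ln (max (exp (- real k)) (opnorm1 (mean_product q p \<omega> N))))"
    "(\<integral>\<omega>. ln (max (exp (- real k)) (opnorm1 (mean_product q p \<omega> N))) \<partial>P) < 0"
    using truncated_log_integral_neg[of "\<lambda>\<omega>. opnorm1 (mean_product q p \<omega> N)" P] opnorm1_nonneg E.finite_measure_axioms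
    by auto
  define I where "I = (\<integral>\<omega>. ln (max (exp (- real k)) (opnorm1 (mean_product q p \<omega> N))) \<partial>P)"
  \<comment> \<open>\<open>I / N\<close> is the mean of the truncated logarithm per step. Half of it
    is kept as the rate, so that \<open>g N\<close> below has mean \<open>I / 2\<close>.\<close>
  define e where "e = - I / (2 * real N)"
  have I: "I < 0" using k(2) by (simp only: I_def)
  have e: "0 < e" unfolding e_def using I N by (intro divide_pos_pos) auto
  \<comment> \<open>The cutoff \<open>exp (- c * real n)\<close> is multiplicative in
    \<open>n\<close>, so \<open>t\<close> remains submultiplicative; with \<open>c = k / N\<close>
    it is the required \<open>exp (- real k)\<close> at \<open>n = N\<close>.\<close>
  define c where "c = real k / real N"
  define t where "t n \<omega> = max (exp (- c * real n)) (backward_norm n \<omega>)" for n \<omega>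
  define g where "g n \<omega> = ln (t n \<omega>) + e * real n" for n \<omega>
  have [measurable]: "t n \<in> borel_measurable P" for n unfolding t_def by measurable
  have t_pos: "0 < t n \<omega>" for n \<omega> by (simp add: t_def less_max_iff_disj)
  have t_sub: "t (n + l) \<omega> \<le> t n \<omega> * t l ((env_unshift ^^ n) \<omega>)" if \<omega>: "\<omega> \<in> space P" for n l \<omega>
    unfolding t_def[of "n + l"]
  proof (rule max.boundedI)
    have "exp (- c * real (n + l)) = exp (- c * real n) * exp (- c * real l)"
      by (simp add: exp_add[symmetric] algebra_simps)
    also have "\<dots> \<le> t n \<omega> * t l ((env_unshift ^^ n) \<omega>)"
      unfolding t_def by (intro mult_mono) (auto simp: le_max_iff_disj)
    finally show "exp (- c * real (n + l)) \<le> t n \<omega> * t l ((env_unshift ^^ n) \<omega>)" .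
    have "backward_norm (n + l) \<omega> \<le> backward_norm n \<omega> * backward_norm l ((env_unshift ^^ n) \<omega>)"
      by (rule backward_norm_add[OF \<omega>])
    also have "\<dots> \<le> t n \<omega> * t l ((env_unshift ^^ n) \<omega>)"
      unfolding t_def by (intro mult_mono) (auto simp: backward_norm_nonneg max.coboundedI2)
    finally show "backward_norm (n + l) \<omega> \<le> t n \<omega> * t l ((env_unshift ^^ n) \<omega>)" .
  qed
  have tN: "t N \<omega> = max (exp (- real k)) (opnorm1 (mean_product q p ((env_unshift ^^ N) \<omega>) N))" for \<omega>
    using N by (simp add: t_def c_def backward_norm_def)
  have "AE \<omega> in P. bdd_above (range (\<lambda>n. g n \<omega>))"
  proof (rule U.subadditive_AE_bdd_above[where N = N])
    show "g n \<in> borel_measurable P" for n unfolding g_def by measurable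
    show "g (n + l) \<omega> \<le> g n \<omega> + g l ((env_unshift ^^ n) \<omega>)" if "\<omega> \<in> space P" for n l \<omega>
    proof -
      have "ln (t (n + l) \<omega>) \<le> ln (t n \<omega> * t l ((env_unshift ^^ n) \<omega>))"
        using t_sub[OF that] t_pos by (subst ln_le_cancel_iff) auto
      also have "\<dots> = ln (t n \<omega>) + ln (t l ((env_unshift ^^ n) \<omega>))"
        by (rule ln_mult_pos) (rule t_pos)+
      finally show ?thesis by (simp add: g_def algebra_simps)
    qed
    show "integrable P (\<lambda>\<omega>. max 0 (g n \<omega>))" for n
    proof (rule Bochner_Integration.integrable_bound)
      show "integrable P (\<lambda>\<omega>. ln (max 1 (backward_norm n \<omega>)) + e * real n)"
        using backward_norm_log_plus_integrable by auto
      show "AE \<omega> in P. norm (max 0 (g n \<omega>)) \<le> norm (ln (max 1 (backward_norm n \<omega>)) + e * real n)"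
      proof (rule AE_I2)
        fix \<omega>
        have "exp (- c * real n) \<le> 1" by (simp add: c_def)
        then have "t n \<omega> \<le> max 1 (backward_norm n \<omega>)" unfolding t_def by (intro max.mono) auto
        then have "ln (t n \<omega>) \<le> ln (max 1 (backward_norm n \<omega>))"
          using t_pos by (subst ln_le_cancel_iff) auto
        moreover have "0 \<le> e * real n" using e by simp
        moreover have "0 \<le> ln (max 1 (backward_norm n \<omega>))" by simp
        ultimately show "norm (max 0 (g n \<omega>)) \<le> norm (ln (max 1 (backward_norm n \<omega>)) + e * real n)"
          unfolding g_def real_norm_def by linarith
      qed
    qed (unfold g_def, measurable)
    have lnN: "integrable P (\<lambda>\<omega>. ln (t N \<omega>))" "(\<integral>\<omega>. ln (t N \<omega>) \<partial>P) = I"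
      unfolding tN I_def by (rule U.integrable_funpow[OF k(1)], rule U.integral_funpow) measurable
    show "integrable P (g N)" unfolding g_def using lnN by auto
    have "(\<integral>\<omega>. g N \<omega> \<partial>P) = I + e * real N"
      unfolding g_def using lnN by (simp add: E.prob_space)
    also have "\<dots> = I / 2" using N by (simp add: e_def field_simps)
    finally show "(\<integral>\<omega>. g N \<omega> \<partial>P) < 0" using I by simp
  qed
  then have "AE \<omega> in P. \<exists>C. \<forall>n. backward_norm n \<omega> \<le> C * exp (- e * real n)"
  proof eventually_elim
    case (elim \<omega>)
    then obtain C where C: "\<And>n. g n \<omega> \<le> C" by (auto simp: bdd_above_def)
    have "backward_norm n \<omega> \<le> exp C * exp (- e * real n)" for n
    proof -
      have "backward_norm n \<omega> \<le> exp (ln (t n \<omega>))" using t_pos by (simp add: t_def less_max_iff_disj)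
      also have "\<dots> \<le> exp (C - e * real n)" using C[of n] by (simp add: g_def)
      finally show ?thesis by (simp add: exp_diff exp_minus divide_inverse)
    qed
    then show ?case by blast
  qed
  with e show ?thesis by blast
qed

text \<open>Products decay like \<open>exp (- e * j)\<close>, while (A1) lets the immigration mean
  grow at most like \<open>exp (e / 2 * j)\<close>, up to constants; a geometric series with ratio
  \<open>exp (- e / 2)\<close> remains.\<close>

lemma population_mean_backward_bounded:
  "AE \<omega> in P. bdd_above (range (\<lambda>n. norm1 (population_mean ((env_unshift ^^ n) \<omega>) n)))"
proof -
  obtain e where e: "0 < e" and decay: "AE \<omega> in P. \<exists>C. \<forall>n. backward_norm n \<omega> \<le> C * exp (- e * real n)"
    using backward_norm_decay by auto
  have "integrable P (\<lambda>\<omega>. ln (max 1 (norm1 (imm_mean q p \<omega> 0))))"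
    by (rule integrable_log_plus) (use log_imm in \<open>auto simp: norm1_nonneg\<close>)
  then have "AE \<omega> in P. \<exists>C. \<forall>n. ln (max 1 (norm1 (imm_mean q p ((env_unshift ^^ n) \<omega>) 0))) \<le> C + e / 2 * real n"
    using e by (intro U.integrable_AE_sublinear) auto
  with decay AE_space show ?thesis
  proof eventually_elim
    case (elim \<omega>)
    let ?b = "\<lambda>j. norm1 (imm_mean q p ((env_unshift ^^ j) \<omega>) 0)"
    obtain C1 where C1: "\<And>n. backward_norm n \<omega> \<le> C1 * exp (- e * real n)" using elim by auto
    obtain C2 where C2: "\<And>n. ln (max 1 (?b n)) \<le> C2 + e / 2 * real n" using elim by auto
    have "0 \<le> C1" using C1[of 0] backward_norm_nonneg[of 0 \<omega>] by simp
    define r where "r = exp (- e / 2)"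
    have r: "0 < r" "r < 1" using e by (auto simp: r_def)
    have rj: "exp (- e * real j) * exp (e / 2 * real j) = r ^ j" for j
      by (simp add: r_def exp_of_nat_mult[symmetric] exp_add[symmetric] algebra_simps)
    have term_le: "backward_norm j \<omega> * ?b j \<le> C1 * exp C2 * r ^ j" for j
    proof -
      have "?b j \<le> exp (ln (max 1 (?b j)))" by simp
      also have "\<dots> \<le> exp (C2 + e / 2 * real j)" using C2[of j] by (simp only: exp_le_cancel_iff)
      finally have "backward_norm j \<omega> * ?b j \<le> (C1 * exp (- e * real j)) * exp (C2 + e / 2 * real j)"
        using C1 \<open>0 \<le> C1\<close> by (intro mult_mono) (auto simp: norm1_nonneg)
      also have "\<dots> = C1 * exp C2 * (exp (- e * real j) * exp (e / 2 * real j))" by (simp add: exp_add)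
      finally show ?thesis unfolding rj .
    qed
    have "norm1 (population_mean ((env_unshift ^^ n) \<omega>) n) \<le> C1 * exp C2 * (1 / (1 - r))" for n
    proof -
      have "norm1 (population_mean ((env_unshift ^^ n) \<omega>) n) \<le> (\<Sum>j=1..n. C1 * exp C2 * r ^ j)"
        by (rule order_trans[OF population_mean_backward_le[OF elim(2)] sum_mono[OF term_le]])
      also have "\<dots> = C1 * exp C2 * (\<Sum>j=1..n. r ^ j)" by (simp add: sum_distrib_left)
      also have "(\<Sum>j=1..n. r ^ j) \<le> (\<Sum>j. r ^ j)"
        using r by (intro sum_le_suminf summable_geometric) auto
      also have "(\<Sum>j. r ^ j) = 1 / (1 - r)" using r by (intro suminf_geometric) auto
      finally show ?thesis using \<open>0 \<le> C1\<close> by (simp add: mult_left_mono)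
    qed
    then show ?case by (auto simp: bdd_above_def)
  qed
qed

text \<open>Uniformity is obtained on the backward side, where the single event \<open>A B\<close>
  contains the exceedances for all \<open>n\<close>; stationarity then equates forward and backward
  probabilities for each fixed \<open>n\<close>.\<close>

lemma population_mean_tight:
  assumes d: "0 < d"
  shows "\<exists>B. \<forall>n. E.prob {\<omega> \<in> space P. B < norm1 (population_mean \<omega> n)} < d"
proof -
  let ?f = "\<lambda>n \<omega>. norm1 (population_mean ((env_unshift ^^ n) \<omega>) n)"
  have [measurable]: "?f n \<in> borel_measurable P" for n
    by (rule measurable_compose[OF U.funpow_meas]) measurable
  define A where "A B = {\<omega> \<in> space P. \<exists>n. real B < ?f n \<omega>}" for B :: nat
  have [measurable]: "A B \<in> sets P" for B unfolding A_def by measurable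
  have "(\<lambda>B. E.prob (A B)) \<longlonglongrightarrow> E.prob (\<Inter>B. A B)"
  proof (rule E.finite_Lim_measure_decseq)
    show "decseq A" unfolding decseq_def
    proof (intro allI impI)
      fix B B' :: nat assume "B \<le> B'"
      then have "real B \<le> real B'" by simp
      then show "A B' \<subseteq> A B" unfolding A_def by (blast intro: order_le_less_trans)
    qed
  qed auto
  moreover have "E.prob (\<Inter>B. A B) = 0"
  proof -
    have "AE \<omega> in P. \<omega> \<notin> (\<Inter>B. A B)"
      using population_mean_backward_bounded
    proof eventually_elim
      case (elim \<omega>)
      then obtain C where C: "\<And>n. ?f n \<omega> \<le> C" by (auto simp: bdd_above_def)
      obtain B :: nat where "C \<le> real B" using real_arch_simple by blast
      then have "\<omega> \<notin> A B" using C by (auto simp: A_def not_less intro: order_trans)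
      then show ?case by auto
    qed
    then show ?thesis by (simp add: AE_iff_measurable[OF _ refl] E.prob_eq_0)
  qed
  ultimately have "\<forall>\<^sub>F B in sequentially. E.prob (A B) < d" using d by (intro order_tendstoD(2)) auto
  then obtain B where B: "E.prob (A B) < d" by (auto simp: eventually_sequentially)
  have "E.prob {\<omega> \<in> space P. real B < norm1 (population_mean \<omega> n)} < d" for n
  proof -
    have "E.prob {\<omega> \<in> space P. real B < norm1 (population_mean \<omega> n)}
      = E.prob ((env_unshift ^^ n) -` {\<omega> \<in> space P. real B < norm1 (population_mean \<omega> n)} \<inter> space P)"
      by (rule U.prob_vimage_funpow[symmetric]) measurable
    also have "\<dots> \<le> E.prob (A B)"
      by (rule E.finite_measure_mono) (auto simp: A_def)
    finally show ?thesis using B by simp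
  qed
  then show ?thesis by blast
qed

end

section \<open>Zeros of the process\<close>

definition zero_count :: "(nat \<Rightarrow> 'b::zero) \<Rightarrow> nat \<Rightarrow> nat" where
  "zero_count Z n = card {k \<in> {1..n}. Z k = 0}"

lemma zero_count_0 [simp]: "zero_count Z 0 = 0"
  by (simp add: zero_count_def)

lemma zero_count_Suc: "zero_count Z (Suc n) = zero_count Z n + (if Z (Suc n) = 0 then 1 else 0)"
proof -
  have "{k \<in> {1..Suc n}. Z k = 0} = {k \<in> {1..n}. Z k = 0} \<union> (if Z (Suc n) = 0 then {Suc n} else {})"
    by (auto simp: le_Suc_eq)
  then show ?thesis by (simp add: zero_count_def)
qed

lemma zero_count_le: "zero_count Z n \<le> n"
  by (induction n) (auto simp: zero_count_Suc)

lemma zero_count_mono: "n \<le> k \<Longrightarrow> zero_count Z n \<le> zero_count Z k"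
  by (rule lift_Suc_mono_le[of "zero_count Z"]) (auto simp: zero_count_Suc)

lemma zero_count_add: "zero_count Z (n + k) = zero_count Z n + zero_count (\<lambda>k. Z (n + k)) k"
  by (induction k) (auto simp: zero_count_Suc)

lemma zero_count_le_of_imp: "(\<And>k. Z k = 0 \<Longrightarrow> Z' k = 0) \<Longrightarrow> zero_count Z n \<le> zero_count Z' n"
  by (induction n) (auto simp: zero_count_Suc)

lemma zero_count_first:
  assumes "Suc n \<le> zero_count Z k"
  obtains i where "Suc i \<le> k" "Z (Suc i) = 0" "zero_count Z i = n"
  using assms
proof (induction k arbitrary: thesis)
  case (Suc k)
  show ?case
  proof (cases "Suc n \<le> zero_count Z k")
    case True
    show ?thesis by (rule Suc.IH[OF _ True]) (rule Suc.prems(1), auto)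
  next
    case False
    then have "Z (Suc k) = 0" "zero_count Z k = n"
      using Suc.prems(2) by (auto simp: zero_count_Suc split: if_splits)
    then show ?thesis by (intro Suc.prems(1)) auto
  qed
qed simp

lemma Inf_enat_le_iff: "Inf {enat i | i. A i} \<le> enat k \<longleftrightarrow> (\<exists>i\<le>k. A i)"
proof
  assume le: "Inf {enat i | i. A i} \<le> enat k"
  then have "{enat i | i. A i} \<noteq> {}" by (metis Inf_empty enat_ord_code(5) infinity_ileE top_enat_def)
  then obtain i where "enat i \<in> {enat i | i. A i}" by blast
  then have "Inf {enat i | i. A i} \<in> {enat i | i. A i}" by (rule wellorder_InfI)
  then show "\<exists>i\<le>k. A i" using le by force
next
  assume "\<exists>i\<le>k. A i"
  then obtain i where "i \<le> k" "A i" by blast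
  then show "Inf {enat i | i. A i} \<le> enat k" by (intro Inf_lower2[of "enat i"]) auto
qed

text \<open>Zero times are the generalized inverse of the zero count, so their measurability and
  their asymptotics both reduce to the count.\<close>

lemma zero_time_le_iff: "zero_time Z n \<le> enat k \<longleftrightarrow> n \<le> zero_count Z k"
proof (induction n arbitrary: k)
  case (Suc n)
  have less: "zero_time Z n < enat (Suc i) \<longleftrightarrow> n \<le> zero_count Z i" for i
    using Suc[of i] by (cases "zero_time Z n") auto
  have "zero_time Z (Suc n) \<le> enat k \<longleftrightarrow> (\<exists>i\<le>k. zero_time Z n < enat i \<and> Z i = 0)"
    by (simp add: Inf_enat_le_iff)
  also have "\<dots> \<longleftrightarrow> (\<exists>i. Suc i \<le> k \<and> n \<le> zero_count Z i \<and> Z (Suc i) = 0)"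
    unfolding less[symmetric] by (metis enat_0 i0_lb not0_implies_Suc not_less)
  also have "\<dots> \<longleftrightarrow> Suc n \<le> zero_count Z k"
  proof
    assume "\<exists>i. Suc i \<le> k \<and> n \<le> zero_count Z i \<and> Z (Suc i) = 0"
    then obtain i where "Suc i \<le> k" "n \<le> zero_count Z i" "Z (Suc i) = 0" by auto
    then show "Suc n \<le> zero_count Z k"
      using zero_count_mono[of "Suc i" k Z] by (simp add: zero_count_Suc)
  next
    assume "Suc n \<le> zero_count Z k"
    then show "\<exists>i. Suc i \<le> k \<and> n \<le> zero_count Z i \<and> Z (Suc i) = 0"
      by (elim zero_count_first) auto
  qed
  finally show ?case .
qed (simp add: zero_enat_def)

text \<open>Made for measurability: a countable supremum over events of the count. The term is
  \<open>Suc k\<close> because a count below \<open>n\<close> at time \<open>k\<close> puts the zero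
  time at \<open>k + 1\<close> or later.\<close>

lemma ereal_zero_time_eq_SUP:
  "ereal_of_enat (zero_time Z n) = (SUP k. if zero_count Z k < n then ereal (real (Suc k)) else 0)"
proof (cases "zero_time Z n")
  case (enat t)
  have iff: "zero_count Z k < n \<longleftrightarrow> k < t" for k
    using zero_time_le_iff[of Z n k] enat by auto
  have "(SUP k. if k < t then ereal (real (Suc k)) else 0) = ereal (real t)"
  proof (cases t)
    case (Suc s)
    show ?thesis
    proof (rule antisym)
      show "ereal (real t) \<le> (SUP k. if k < t then ereal (real (Suc k)) else 0)"
        by (rule SUP_upper2[of s]) (auto simp: Suc)
    qed (rule SUP_least, auto)
  qed (simp add: zero_ereal_def[symmetric])
  then show ?thesis using enat by (simp add: iff)
next
  case infinity
  then have "zero_count Z k < n" for k using zero_time_le_iff[of Z n k] by auto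
  moreover have "(SUP k. ereal (real (Suc k))) = \<infinity>"
  proof (rule SUP_PInfty)
    fix n show "\<exists>i\<in>UNIV. ereal (real n) \<le> ereal (real (Suc i))" by (intro bexI[of _ n]) auto
  qed
  ultimately show ?thesis using infinity by simp
qed

context
  fixes Z :: "nat \<Rightarrow> 'b::zero" and c :: real
  assumes c: "0 < c" and lim: "(\<lambda>n. real (zero_count Z n) / real n) \<longlonglongrightarrow> c"
begin

lemma zero_count_unbounded: "\<exists>k. n \<le> zero_count Z k"
proof (rule ccontr)
  assume "\<nexists>k. n \<le> zero_count Z k"
  then have "zero_count Z k \<le> n" for k by (meson nat_le_linear)
  then have "real (zero_count Z k) / real k \<le> real n / real k" for k
    by (intro divide_right_mono) auto
  then have "c \<le> 0"
    by (intro LIMSEQ_le[OF lim lim_const_over_n[of "real n"]]) auto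
  with c show False by simp
qed

lemma infinitely_many_zeros: "\<exists>\<^sub>\<infinity>n. Z n = 0"
  unfolding INFM_nat
proof
  fix n
  obtain k where "Suc n \<le> zero_count Z k" using zero_count_unbounded by blast
  then have k: "zero_count Z n < zero_count Z k" using zero_count_le[of Z n] by simp
  then have "n \<le> k" using zero_count_mono[of k n Z] by linarith
  show "\<exists>m>n. Z m = 0"
  proof (rule ccontr)
    assume none: "\<nexists>m. n < m \<and> Z m = 0"
    have "{i \<in> {1..k}. Z i = 0} = {i \<in> {1..n}. Z i = 0}"
      using none \<open>n \<le> k\<close> by (auto simp: not_less[symmetric])
    then show False using k by (simp add: zero_count_def)
  qed
qed

lemma zero_time_asymptotics:
  "(\<lambda>n. ereal_of_enat (zero_time Z n) / ereal (real n)) \<longlonglongrightarrow> ereal (1 / c)"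
proof -
  define t where "t n = (LEAST k. n \<le> zero_count Z k)" for n
  have t: "n \<le> zero_count Z (t n)" for n
    unfolding t_def using zero_count_unbounded by (rule LeastI_ex)
  have t_least: "t n \<le> k" if "n \<le> zero_count Z k" for n k
    unfolding t_def using that by (rule Least_le)
  have zt: "zero_time Z n = enat (t n)" for n
  proof -
    have le: "zero_time Z n \<le> enat (t n)" using t by (simp add: zero_time_le_iff)
    then obtain j where j: "zero_time Z n = enat j" by (cases "zero_time Z n") auto
    then have "n \<le> zero_count Z j" using zero_time_le_iff[of Z n j] by simp
    then show ?thesis using t_least le j by (auto intro: antisym)
  qed
  \<comment> \<open>The count rises by at most one per step, so when it first reaches
    \<open>n\<close> it equals \<open>n\<close>. Thus \<open>n / t n\<close> is the frequency of
    zeros along the subsequence \<open>t\<close>.\<close>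
  have t_count: "zero_count Z (t n) = n" for n
  proof (cases "t n")
    case (Suc s)
    then have "zero_count Z s < n" using t_least[of n s] by (cases "n \<le> zero_count Z s") auto
    then show ?thesis using t[of n] Suc by (auto simp: zero_count_Suc split: if_splits)
  qed (use t[of n] in auto)
  have "n \<le> t n" for n using t[of n] zero_count_le[of Z "t n"] by simp
  then have "filterlim t at_top sequentially"
    by (intro filterlim_at_top_mono[OF filterlim_ident] always_eventually) auto
  then have "(\<lambda>n. real (zero_count Z (t n)) / real (t n)) \<longlonglongrightarrow> c"
    by (rule filterlim_compose[OF lim])
  then have "(\<lambda>n. inverse (real n / real (t n))) \<longlonglongrightarrow> inverse c"
    using c by (intro tendsto_inverse) (auto simp: t_count)
  then have "(\<lambda>n. real (t n) / real n) \<longlonglongrightarrow> 1 / c"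
    by (simp add: field_simps)
  then have "(\<lambda>n. ereal (real (t n) / real n)) \<longlonglongrightarrow> ereal (1 / c)" by simp
  then show ?thesis
  proof (rule Lim_transform_eventually)
    show "\<forall>\<^sub>F n in sequentially. ereal (real (t n) / real n) = ereal_of_enat (zero_time Z n) / ereal (real n)"
      using eventually_gt_at_top[of 0] by eventually_elim (simp add: zt)
  qed
qed

end

section \<open>The frequency of zeros under the annealed law\<close>

context branching_environment
begin

lemma zero_set [measurable]: "{x. branching z x n = 0} \<in> sets noise_space"
  using measurable_sets[OF branching_measurable[of z n], of "{0}"] by (simp add: vimage_def)

lemma annealed_snd_measurable: "f \<in> noise_space \<rightarrow>\<^sub>M N \<Longrightarrow> (\<lambda>y. f (snd y)) \<in> \<AA> \<rightarrow>\<^sub>M N"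
  unfolding measurable_cong_sets[OF sets_annealed refl] by (rule measurable_compose[OF measurable_snd])

lemma zero_count_measurable: "(\<lambda>x :: 'd noise. real (zero_count (branching 0 x) n)) \<in> borel_measurable noise_space"
proof (induction n)
  case (Suc n)
  have "(\<lambda>x :: 'd noise. real (zero_count (branching 0 x) n) + indicator {x. branching 0 x (Suc n) = 0} x) \<in> borel_measurable noise_space"
    by (intro borel_measurable_add Suc borel_measurable_indicator zero_set)
  moreover have "real (zero_count (branching 0 x) (Suc n)) = real (zero_count (branching 0 x) n) + indicator {x. branching 0 x (Suc n) = 0} x"
    for x :: "'d noise" by (simp add: zero_count_Suc del: branching.simps)
  ultimately show ?case by (simp only:)
qed simp

lemma zero_time_measurable: "(\<lambda>x :: 'd noise. ereal_of_enat (zero_time (branching 0 x) n)) \<in> borel_measurable noise_space"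
proof -
  have "Measurable.pred noise_space (\<lambda>x :: 'd noise. real (zero_count (branching 0 x) k) < real n)" for k
    using zero_count_measurable[of k] by measurable
  then have "Measurable.pred noise_space (\<lambda>x :: 'd noise. zero_count (branching 0 x) k < n)" for k
    by simp
  then show ?thesis unfolding ereal_zero_time_eq_SUP by measurable
qed

lemma AE_annealed_prob_one:
  assumes "Measurable.pred noise_space R" and "AE y in \<AA>. R (snd y)"
  shows "measure \<AA> {(\<omega>, x) \<in> space \<AA>. R x} = 1"
proof -
  have "{y \<in> space \<AA>. R (snd y)} \<in> sets \<AA>"
    using annealed_snd_measurable[OF assms(1)] by (simp add: pred_def)
  then have "measure \<AA> {y \<in> space \<AA>. R (snd y)} = 1"
    using assms(2) by (simp add: A.prob_Collect_eq_1)
  moreover have "{(\<omega>, x) \<in> space \<AA>. R x} = {y \<in> space \<AA>. R (snd y)}" by auto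
  ultimately show ?thesis by simp
qed

lemma zero_event: "{y \<in> space \<AA>. branching 0 (snd y) n = 0} \<in> sets \<AA>"
  using measurable_sets[OF annealed_snd_measurable[OF branching_measurable[of 0 n]], of "{0}"]
  by (simp add: vimage_def Int_def conj_commute)

lemma zero_prob_antimono:
  "A.prob {y \<in> space \<AA>. branching 0 (snd y) (n + k) = 0} \<le> A.prob {y \<in> space \<AA>. branching 0 (snd y) k = 0}"
proof -
  have "A.prob {y \<in> space \<AA>. branching 0 (snd y) (n + k) = 0}
    \<le> A.prob ((joint_shift ^^ n) -` {y \<in> space \<AA>. branching 0 (snd y) k = 0} \<inter> space \<AA>)"
  proof (rule A.finite_measure_mono)
    show "{y \<in> space \<AA>. branching 0 (snd y) (n + k) = 0}
      \<subseteq> (joint_shift ^^ n) -` {y \<in> space \<AA>. branching 0 (snd y) k = 0} \<inter> space \<AA>"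
      using measurable_space[OF A.funpow_meas[of n]]
      by (auto simp: joint_shift_funpow dest: branching_shift_eq_0)
  qed (rule measurable_sets[OF A.funpow_meas zero_event])
  also have "\<dots> = A.prob {y \<in> space \<AA>. branching 0 (snd y) k = 0}"
    by (rule A.prob_vimage_funpow[OF zero_event])
  finally show ?thesis .
qed

text \<open>The mean zero count is the sum of the probabilities of a zero at times 1 to
  \<open>n\<close>, hence at least \<open>d * n\<close>. This keeps the subadditive constant at
  least \<open>d\<close>, as the positivity hypothesis of \<open>bounded_subadditive_ergodic\<close>
  requires.\<close>

lemma zero_frequency:
  assumes d: "0 < d" and pos: "\<And>k. d \<le> A.prob {y \<in> space \<AA>. branching 0 (snd y) k = 0}"
  shows "\<exists>c>0. AE y in \<AA>. (\<lambda>n. real (zero_count (branching 0 (snd y)) n) / real n) \<longlonglongrightarrow> c"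
proof -
  define g where "g n y = real (zero_count (branching 0 (snd y)) n)" for n and y :: "(int \<Rightarrow> 'a) \<times> 'd noise"
  have [measurable]: "g n \<in> borel_measurable \<AA>" for n
    unfolding g_def by (rule annealed_snd_measurable[OF zero_count_measurable])
  have g_int: "integrable \<AA> (g n)" for n
    by (rule A.integrable_const_bound[of _ "real n"]) (auto simp: g_def zero_count_le)
  have mean: "d * real n \<le> (\<integral>y. g n y \<partial>\<AA>)" for n
  proof (induction n)
    case (Suc n)
    let ?C = "{y \<in> space \<AA>. branching 0 (snd y) (Suc n) = 0}"
    have "(\<integral>y. g (Suc n) y \<partial>\<AA>) = (\<integral>y. g n y + indicator ?C y \<partial>\<AA>)"
      by (rule Bochner_Integration.integral_cong) (auto simp: g_def zero_count_Suc indicator_def simp del: branching.simps)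
    also have "\<dots> = (\<integral>y. g n y \<partial>\<AA>) + A.prob ?C"
      using g_int zero_event[of "Suc n"] by (subst Bochner_Integration.integral_add) (auto simp: A.emeasure_eq_measure)
    finally show ?case using Suc pos[of "Suc n"] by (simp add: algebra_simps)
  qed (simp add: g_def)
  define c where "c = (INF n\<in>{1..}. (\<integral>y. g n y \<partial>\<AA>) / real n)"
  have "d \<le> c"
    unfolding c_def using mean by (intro cINF_greatest) (auto simp: field_simps)
  then have "0 < c" using d by simp
  have "AE y in \<AA>. (\<lambda>n. g n y / real n) \<longlonglongrightarrow> c"
    unfolding c_def
  proof (rule A.bounded_subadditive_ergodic)
    show "g (n + k) y \<le> g n y + g k ((joint_shift ^^ n) y)" for n k y
    proof -
      have "zero_count (\<lambda>k. branching 0 (snd y) (n + k)) k \<le> zero_count (branching 0 ((noise_shift ^^ n) (snd y))) k"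
        by (rule zero_count_le_of_imp) (rule branching_shift_eq_0)
      then show ?thesis
        by (cases y) (simp add: g_def zero_count_add joint_shift_funpow)
    qed
    show "0 \<le> g n y \<and> g n y \<le> real n" for n y by (simp add: g_def zero_count_le)
    show "0 < (INF n\<in>{1..}. (\<integral>y. g n y \<partial>\<AA>) / real n)" using \<open>0 < c\<close> by (simp add: c_def)
  qed simp
  then show ?thesis using \<open>0 < c\<close> unfolding g_def by blast
qed

text \<open>
  From a population of at most \<open>K\<close> of each type at time \<open>n\<close>, the process is
  dominated by the one started from \<open>K\<close> of each type.
\<close>

lemma quenched_zero_prob_ge:
  fixes K :: nat
  assumes \<omega>: "\<omega> \<in> space P"
  shows "emeasure (Q \<omega>) {x. \<forall>j. branching 0 x n $ j \<le> K} * emeasure (Q ((env_shift ^^ n) \<omega>)) {x. branching (\<chi> i. K) x m = 0}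
    \<le> emeasure (Q \<omega>) {x. branching 0 x (n + m) = 0}"
proof -
  note [simp] = measurable_quenched[OF \<omega>] sets_quenched[OF \<omega>] space_quenched[OF \<omega>]
  let ?D = "{x. \<forall>j. branching 0 x n $ j \<le> K}" and ?E = "{x. branching (\<chi> i. K) x m = 0}"
  let ?E' = "{x. branching (\<chi> i. K) ((noise_shift ^^ n) x) m = 0}"
  have D: "?D \<in> sets noise_space"
    using measurable_sets[OF branching_measurable[of 0 n], of "{k. \<forall>j. k $ j \<le> K}"] by (simp add: vimage_def)
  have E': "?E' \<in> sets noise_space"
    using measurable_sets[OF noise_shift_funpow_measurable[of n] zero_set[of "\<chi> i. K" m]] by (simp add: vimage_def)
  have "emeasure (Q ((env_shift ^^ n) \<omega>)) ?E = emeasure (distr (Q \<omega>) noise_space (noise_shift ^^ n)) ?E"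
    by (simp add: quenched_shift_funpow[OF \<omega>])
  also have "\<dots> = emeasure (Q \<omega>) ((noise_shift ^^ n) -` ?E \<inter> space (Q \<omega>))"
    by (rule emeasure_distr) (auto simp: zero_set)
  also have "(noise_shift ^^ n) -` ?E \<inter> space (Q \<omega>) = ?E'" by auto
  finally have EE: "emeasure (Q ((env_shift ^^ n) \<omega>)) ?E = emeasure (Q \<omega>) ?E'" .
  \<comment> \<open>\<open>?D\<close> reads sources before time \<open>n\<close>, and
    \<open>?E'\<close> only sources from time \<open>n\<close> on.\<close>
  have "(\<integral>\<^sup>+x. indicator ?D x * indicator ?E' x \<partial>Q \<omega>) = (\<integral>\<^sup>+x. indicator ?D x \<partial>Q \<omega>) * (\<integral>\<^sup>+x. indicator ?E' x \<partial>Q \<omega>)"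
  proof (rule nn_integral_mult_indep[OF \<omega>])
    show "depends_on (indicator ?D :: _ \<Rightarrow> ennreal) {s. source_time s < n}"
      using depends_on_compose[OF branching_depends_on[of 0 n], of "\<lambda>k. \<forall>j. k $ j \<le> K"]
      by (intro depends_on_indicator) simp
    show "depends_on (indicator ?E' :: _ \<Rightarrow> ennreal) ((later ^^ n) ` UNIV)"
      using depends_on_noise_shift[OF depends_on_UNIV, of "\<lambda>x. branching (\<chi> i. K) x m = 0" n]
      by (intro depends_on_indicator) simp
  qed (use D E' in auto)
  moreover have DQ: "?D \<in> sets (Q \<omega>)" "?E' \<in> sets (Q \<omega>)" using D E' by auto
  ultimately have "emeasure (Q \<omega>) ?D * emeasure (Q \<omega>) ?E' = emeasure (Q \<omega>) (?D \<inter> ?E')"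
    unfolding indicator_inter_arith[symmetric]
    by (simp only: nn_integral_indicator[OF DQ(1)] nn_integral_indicator[OF DQ(2)] nn_integral_indicator[OF sets.Int[OF DQ]])
  also have "\<dots> \<le> emeasure (Q \<omega>) {x. branching 0 x (n + m) = 0}"
  proof (rule emeasure_mono)
    show "?D \<inter> ?E' \<subseteq> {x. branching 0 x (n + m) = 0}"
    proof
      fix x assume "x \<in> ?D \<inter> ?E'"
      then have le: "branching 0 x n $ j \<le> K" and 0: "branching (\<chi> i. K) ((noise_shift ^^ n) x) m = 0" for j
        by auto
      have "branching (branching 0 x n) ((noise_shift ^^ n) x) m $ i \<le> branching (\<chi> i. K) ((noise_shift ^^ n) x) m $ i" for i
        by (intro branching_mono) (simp add: le)
      then show "x \<in> {x. branching 0 x (n + m) = 0}" by (simp add: branching_add 0 vec_eq_iff)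
    qed
  qed (simp add: zero_set)
  finally show ?thesis unfolding EE .
qed

end

section \<open>The lower bound on the probability of a zero and the conclusion\<close>

context subcritical_environment
begin

lemma zero_prob_bounded_below:
  assumes ext: "measure P {\<omega> \<in> space P. quenched_extinction q p \<omega> m > 0} > 0"
  shows "\<exists>d>0. \<forall>k. d \<le> A.prob {y \<in> space \<AA>. branching 0 (snd y) k = 0}"
proof -
  define r where "r = measure P {\<omega> \<in> space P. quenched_extinction q p \<omega> m > 0}"
  have r: "0 < r" using ext by (simp add: r_def)
  \<comment> \<open>The order of choices matters: \<open>B\<close> is chosen from \<open>r\<close>
    alone and \<open>K\<close> from \<open>B\<close>. Only then is \<open>h\<close> formed; it is
    positive on the whole extinction event, so its threshold may shrink with \<open>K\<close> while
    \<open>H j\<close> keeps probability above \<open>r / 2\<close>.\<close>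
  obtain B where B: "\<And>n. E.prob {\<omega> \<in> space P. B < norm1 (population_mean \<omega> n)} < r / 4"
    using population_mean_tight[of "r / 4"] r by auto
  \<comment> \<open>With \<open>K\<close> at least \<open>2 * B\<close>, the Markov bound on a count
    above \<open>K\<close> is at most 1/2 wherever the mean norm is at most
    \<open>B\<close>.\<close>
  obtain K :: nat where K: "2 * B \<le> real K" using real_arch_simple by blast
  define h where "h \<omega> = measure (Q \<omega>) {x. branching (\<chi> i. K) x m = 0}" for \<omega>
  have [measurable]: "h \<in> borel_measurable P" unfolding h_def
    by (rule measurable_compose[OF quenched_measurable_subprob measurable_measure_subprob_algebra]) (rule zero_set)
  define H where "H j = {\<omega> \<in> space P. 1 / real (Suc j) < h \<omega>}" for j
  have [measurable]: "H j \<in> sets P" for j unfolding H_def by measurable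
  have "(\<lambda>j. E.prob (H j)) \<longlonglongrightarrow> E.prob (\<Union>j. H j)"
  proof (rule E.finite_Lim_measure_incseq)
    show "incseq H"
    proof (rule incseq_SucI)
      fix j
      have "1 / real (Suc (Suc j)) \<le> 1 / real (Suc j)" by (intro divide_left_mono) auto
      then show "H j \<subseteq> H (Suc j)" by (auto simp: H_def)
    qed
  qed auto
  moreover have "r \<le> E.prob (\<Union>j. H j)"
    unfolding r_def
  proof (rule E.finite_measure_mono)
    show "{\<omega> \<in> space P. quenched_extinction q p \<omega> m > 0} \<subseteq> (\<Union>j. H j)"
    proof safe
      fix \<omega> assume \<omega>: "\<omega> \<in> space P" and "0 < quenched_extinction q p \<omega> m"
      then have "emeasure (Q \<omega>) {x. branching (\<chi> i. K) x m = 0} \<noteq> 0"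
        by (intro extinction_pos_all_starts)
      then have "0 < h \<omega>"
        using finite_measure.emeasure_eq_measure[OF prob_space.finite_measure[OF prob_space_quenched[OF \<omega>]]]
        by (simp add: h_def zero_less_measure_iff)
      then obtain j where "inverse (real (Suc j)) < h \<omega>" using reals_Archimedean by blast
      then show "\<omega> \<in> (\<Union>j. H j)" using \<omega> by (auto simp: H_def inverse_eq_divide)
    qed
  qed measurable
  ultimately have "\<forall>\<^sub>F j in sequentially. r / 2 < E.prob (H j)"
    using r by (intro order_tendstoD(1)) auto
  then obtain j where j: "r / 2 < E.prob (H j)" by (auto simp: eventually_sequentially)
  define e where "e = 1 / real (Suc j)"
  have e: "0 < e" by (simp add: e_def)
  \<comment> \<open>The environments \<open>G1 - G2\<close> have probability at least
    \<open>r / 2 - r / 4\<close>. On them the population at time \<open>n\<close> is at most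
    \<open>K\<close> in each type with quenched probability at least 1/2, and dying out from there
    has probability at least \<open>e\<close>; the product is \<open>e * r / 8\<close>.\<close>
  have bound: "e * r / 8 \<le> A.prob {y \<in> space \<AA>. branching 0 (snd y) (n + m) = 0}" for n
  proof -
    let ?C = "{y \<in> space \<AA>. branching 0 (snd y) (n + m) = 0}"
    have C: "?C \<in> sets \<AA>" by (rule zero_event)
    define G1 where "G1 = (env_shift ^^ n) -` H j \<inter> space P"
    define G2 where "G2 = {\<omega> \<in> space P. B < norm1 (population_mean \<omega> n)}"
    have [measurable]: "G1 \<in> sets P" "G2 \<in> sets P" unfolding G1_def G2_def by measurable
    have "r / 2 - r / 4 \<le> E.prob G1 - E.prob G2"
      using E.prob_vimage_funpow[of "H j" n] j B[of n] by (simp add: G1_def G2_def)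
    also have "\<dots> \<le> E.prob (G1 - G2)"
    proof -
      have "E.prob G1 \<le> E.prob ((G1 - G2) \<union> G2)" by (rule E.finite_measure_mono) auto
      also have "\<dots> \<le> E.prob (G1 - G2) + E.prob G2" by (rule measure_Un_le) auto
      finally show ?thesis by simp
    qed
    finally have G: "r / 4 \<le> E.prob (G1 - G2)" by simp
    have "ennreal (e / 2) * emeasure P (G1 - G2) = (\<integral>\<^sup>+\<omega>. ennreal (e / 2) * indicator (G1 - G2) \<omega> \<partial>P)"
      by (rule nn_integral_cmult_indicator[symmetric]) auto
    also have "\<dots> \<le> (\<integral>\<^sup>+\<omega>. emeasure (Q \<omega>) (Pair \<omega> -` ?C) \<partial>P)"
    proof (rule nn_integral_mono_AE)
      show "AE \<omega> in P. ennreal (e / 2) * indicator (G1 - G2) \<omega> \<le> emeasure (Q \<omega>) (Pair \<omega> -` ?C)"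
        using AE_finite_means[OF fin_imm fin_off] AE_space
      proof eventually_elim
        case (elim \<omega>)
        note \<omega> = elim(2)
        show ?case
        proof (cases "\<omega> \<in> G1 - G2")
          case True
          interpret Q: prob_space "Q \<omega>" by (rule prob_space_quenched[OF \<omega>])
          interpret Q': prob_space "Q ((env_shift ^^ n) \<omega>)" by (rule prob_space_quenched[OF env_shift_space[OF \<omega>]])
          let ?D = "{x. \<forall>j. branching 0 x n $ j \<le> K}"
          have D: "?D \<in> Q.events"
            using measurable_sets[OF branching_measurable[of 0 n], of "{k. \<forall>j. k $ j \<le> K}"]
            by (simp add: vimage_def sets_quenched[OF \<omega>])
          have "norm1 (population_mean \<omega> n) \<le> B" using True \<omega> by (simp add: G2_def)
          then have "norm1 (population_mean \<omega> n) / real (Suc K) \<le> 1 / 2"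
            using K by (simp add: field_simps)
          then have "emeasure (Q \<omega>) {x. \<exists>j. K < branching 0 x n $ j} \<le> ennreal (1 / 2)"
            using quenched_population_tail[OF \<omega> elim(1), of K n] by (meson ennreal_leI order_trans)
          then have "Q.prob (space (Q \<omega>) - ?D) \<le> 1 / 2"
            unfolding Q.emeasure_eq_measure
            by (subst (asm) ennreal_le_iff) (auto simp: space_quenched[OF \<omega>] Diff_eq Collect_neg_eq[symmetric] not_le)
          then have D_ge: "1 / 2 \<le> Q.prob ?D" using Q.prob_compl[OF D] by simp
          have h_ge: "e \<le> h ((env_shift ^^ n) \<omega>)" using True by (simp add: G1_def H_def e_def)
          have "ennreal (e / 2) = ennreal (1 / 2) * ennreal e"
            by (subst ennreal_mult'[symmetric]) auto
          also have "\<dots> \<le> emeasure (Q \<omega>) ?D * emeasure (Q ((env_shift ^^ n) \<omega>)) {x. branching (\<chi> i. K) x m = 0}"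
            using D_ge h_ge e unfolding Q.emeasure_eq_measure Q'.emeasure_eq_measure h_def
            by (intro mult_mono ennreal_leI) auto
          also have "\<dots> \<le> emeasure (Q \<omega>) {x. branching 0 x (n + m) = 0}"
            by (rule quenched_zero_prob_ge[OF \<omega>])
          also have "{x. branching 0 x (n + m) = 0} = Pair \<omega> -` ?C" using \<omega> by (auto simp: space_annealed)
          finally show ?thesis using True by simp
        qed simp
      qed
    qed
    also have "\<dots> = emeasure \<AA> ?C" by (rule emeasure_annealed'[OF C, symmetric])
    finally have "ennreal (e / 2) * emeasure P (G1 - G2) \<le> emeasure \<AA> ?C" .
    moreover have "0 \<le> e / 2" using e by simp
    ultimately have "ennreal (e / 2 * E.prob (G1 - G2)) \<le> ennreal (A.prob ?C)"
      by (simp only: E.emeasure_eq_measure A.emeasure_eq_measure ennreal_mult')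
    then have "e / 2 * E.prob (G1 - G2) \<le> A.prob ?C" by (subst (asm) ennreal_le_iff) auto
    moreover have "e / 2 * (r / 4) \<le> e / 2 * E.prob (G1 - G2)" using G e by (intro mult_left_mono) auto
    ultimately show ?thesis by simp
  qed
  \<comment> \<open>The bound is known at times \<open>k + m\<close>; monotonicity in time brings it
    back to \<open>k\<close>, covering times below \<open>m\<close> as well.\<close>
  have "e * r / 8 \<le> A.prob {y \<in> space \<AA>. branching 0 (snd y) k = 0}" for k
    using bound[of k] zero_prob_antimono[of m k] by (simp add: add.commute)
  moreover have "0 < e * r / 8" using e r by simp
  ultimately show ?thesis by blast
qed

lemma returns_to_zero:
  assumes ext: "measure P {\<omega> \<in> space P. quenched_extinction q p \<omega> m > 0} > 0"
  shows "measure \<AA> {(\<omega>, x) \<in> space \<AA>. \<exists>\<^sub>\<infinity>n. branching 0 x n = 0} = 1"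
    and "\<exists>\<mu>::real. \<mu> > 0 \<and> measure \<AA> {(\<omega>, x) \<in> space \<AA>.
      (\<lambda>n. ereal_of_enat (zero_time (branching 0 x) n) / ereal (real n)) \<longlonglongrightarrow> ereal \<mu>} = 1"
proof -
  obtain d where "0 < d" "\<And>k. d \<le> A.prob {y \<in> space \<AA>. branching 0 (snd y) k = 0}"
    using zero_prob_bounded_below[OF ext] by auto
  then obtain c where c: "0 < c"
    and lim: "AE y in \<AA>. (\<lambda>n. real (zero_count (branching 0 (snd y)) n) / real n) \<longlonglongrightarrow> c"
    using zero_frequency by blast
  have [measurable]: "Measurable.pred noise_space (\<lambda>x. branching 0 x n = 0)" for n
    using zero_set[of 0 n] by (simp add: pred_def)
  have "AE y in \<AA>. \<exists>\<^sub>\<infinity>n. branching 0 (snd y) n = 0"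
    using lim by eventually_elim (rule infinitely_many_zeros[OF c])
  then show "measure \<AA> {(\<omega>, x) \<in> space \<AA>. \<exists>\<^sub>\<infinity>n. branching 0 x n = 0} = 1"
    by (intro AE_annealed_prob_one) (auto simp: INFM_nat)
  let ?f = "\<lambda>n x. ereal_of_enat (zero_time (branching 0 x) n) / ereal (real n)"
  have [measurable]: "(\<lambda>x. ereal_of_enat (zero_time (branching 0 x) n)) \<in> borel_measurable (noise_space :: 'd noise measure)" for n
    by (rule zero_time_measurable)
  \<comment> \<open>Convergence to a fixed value is written through liminf and limsup, which are
    measurable as limits of measurable extended real functions.\<close>
  have "Measurable.pred noise_space (\<lambda>x :: 'd noise. liminf (\<lambda>n. ?f n x) = ereal (1 / c) \<and> limsup (\<lambda>n. ?f n x) = ereal (1 / c))"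
    by measurable
  then have "Measurable.pred noise_space (\<lambda>x :: 'd noise. (\<lambda>n. ?f n x) \<longlonglongrightarrow> ereal (1 / c))"
    by (simp add: tendsto_iff_Liminf_eq_Limsup[OF sequentially_bot])
  moreover have "AE y in \<AA>. (\<lambda>n. ?f n (snd y)) \<longlonglongrightarrow> ereal (1 / c)"
    using lim by eventually_elim (rule zero_time_asymptotics[OF c])
  ultimately have "measure \<AA> {(\<omega>, x) \<in> space \<AA>. (\<lambda>n. ?f n x) \<longlonglongrightarrow> ereal (1 / c)} = 1"
    by (rule AE_annealed_prob_one)
  then show "\<exists>\<mu>::real. \<mu> > 0 \<and> measure \<AA> {(\<omega>, x) \<in> space \<AA>. (\<lambda>n. ?f n x) \<longlonglongrightarrow> ereal \<mu>} = 1"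
    using c by (intro exI[of _ "1 / c"]) auto
qed

end

theorem theorem1p5:
  fixes S :: "'a measure"
    and P :: "(int \<Rightarrow> 'a) measure"
    and q :: "'a \<Rightarrow> (nat ^ 'd::finite) measure"
    and p :: "'d \<Rightarrow> 'a \<Rightarrow> (nat ^ 'd) measure"
    and m :: nat
  assumes env: "stationary_ergodic_env S P"
    and q_meas: "q \<in> S \<rightarrow>\<^sub>M prob_algebra (count_space UNIV)"
    and p_meas: "\<And>i. p i \<in> S \<rightarrow>\<^sub>M prob_algebra (count_space UNIV)"
    and A1: "AE \<omega> in P. finite_imm_mean q p \<omega> 0"
      "eexpectation P (\<lambda>\<omega>. max 0 (elog (norm1 (imm_mean q p \<omega> 0)))) < \<infinity>"
    and A2: "AE \<omega> in P. finite_offspring_mean q p \<omega> 0"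
      "eexpectation P (\<lambda>\<omega>. max 0 (elog (opnorm1 (offspring_mean q p \<omega> 0)))) < \<infinity>"
    and A3: "\<exists>L<0. (\<lambda>n. ereal (1 / real n) *
        eexpectation P (\<lambda>\<omega>. elog (opnorm1 (mean_product q p \<omega> n)))) \<longlonglongrightarrow> L"
    and m_pos: "m \<ge> 1"
    and ext: "measure P {\<omega> \<in> space P. quenched_extinction q p \<omega> m > 0} > 0"
  shows "measure (annealed q p P)
             {(\<omega>, x) \<in> space (annealed q p P). \<exists>\<^sub>\<infinity>n. branching 0 x n = 0} = 1 \<and>
         (measure P {\<omega> \<in> space P. quenched_extinction q p \<omega> 1 > 0} = 1 \<longrightarrow>
           (\<exists>\<mu>::real. \<mu> > 0 \<and>
              measure (annealed q p P)
                {(\<omega>, x) \<in> space (annealed q p P).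
                   (\<lambda>n. ereal_of_enat (zero_time (branching 0 x) n) / ereal (real n))
                     \<longlonglongrightarrow> ereal \<mu>} = 1))"
proof -
  interpret subcritical_environment S P q p
    by unfold_locales (fact env q_meas p_meas A1 A2 A3)+
  show ?thesis
    by (intro conjI impI returns_to_zero[OF ext])
qed

end
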